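(* Let $\varphi:S^1\to S^1$ be an orientation preserving circle homeomorphism with irrational rotation number $\varrho$, lift $\Phi:\mathbb{R}\to\mathbb{R}$, and unique invariant Borel probability measure $\mu$ (viewed on $[0,1]$). For $x_0\in\mathbb{R}$ and $n\ge1$ put $z_n(x_0)=\sum_{k=0}^{n-1}\exp(2\pi\imath\Phi^k(x_0))$, and let $\Gamma(x_0)$ be the curlicue through $z_0=0,z_1(x_0),z_2(x_0),\dots$. Suppose $\int_0^1\exp(2\pi\imath x)\,d\mu(x)=0$. Then: (1) If $\varrho$ is Diophantine of type $r>1$, then for every $x_0\in\mathbb{R}$, $|z_n(x_0)|=\mathcal{O}(n^{1-1/r}\log n)$. (2) If $\varrho$ is of bounded type, then for every $x_0\in\mathbb{R}$, $|z_n(x_0)|=\mathcal{O}(\log n)$. (3) If there is $\varepsilon>0$ such that the partial quotients $a_m$ of the continued fraction expansion of $\varrho$ satisfy $a_m<(m+1)^{1+\varepsilon}$ for all sufficiently large $m$, then for every $x_0\in\mathbb{R}$, $|z_n(x_0)|=\mathcal{O}(\log^{2+\varepsilon}n)$. In any of the cases (1)–(3), the curve $\Gamma(x_0)$ is superficial. On the other hand, if $v:=\int_0^1\exp(2\pi\imath x)\,d\mu(x)\ne0$, then $\Gamma(x_0)$ is not superficial; and if moreover $\varrho$ satisfies the hypothesis of any of (1)–(3), then there exist a constant $M$ and a function $l$ with $l(n)=o(n)$ such that for all $x_0\in\mathbb{R}$ and $n\in\mathbb{N}$, $|z_n(x_0)-nv|\le Ml(n)$.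
   Context: Identify $S^1=\mathbb{R}/\mathbb{Z}$ via $x\mapsto\exp(2\pi\imath x)$; a lift is $\Phi$ with $\Phi(x+1)=\Phi(x)+1$. A real number $\varrho$ is Diophantine of type $r>1$ if there is $C>0$ with $|\varrho-p/q|\ge C/q^{1+r}$ for all $p/q\in\mathbb{Q}$. $\varrho$ is of bounded type if the denominators $q_n$ of its continued fraction convergents $p_n/q_n$ satisfy $\sup_n q_{n+1}/q_n<\infty$. For $t>0$, $\Gamma_t$ is the initial part of $\Gamma$ of length $t$ and $\Gamma^{\varepsilon}=\{y:\exists x\in\Gamma,|x-y|<\varepsilon\}$. An unbounded curve is superficial if $\lim_{t\to\infty}t/\mathrm{Diam}\,\Gamma_t=\infty$; a bounded curve is superficial if $\lim_{\varepsilon\to0}\mathrm{Area}(\Gamma^{\varepsilon})/\varepsilon=\infty$ (Area = 2-dimensional Lebesgue measure). *)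

theory Defs
  imports "HOL-Probability.Probability" "HOL-Library.Landau_Symbols"
begin

definition circle_homeo_lift :: "(real \<Rightarrow> real) \<Rightarrow> bool" where
  "circle_homeo_lift \<Phi> \<longleftrightarrow> continuous_on UNIV \<Phi> \<and> strict_mono \<Phi> \<and> (\<forall>x. \<Phi> (x + 1) = \<Phi> x + 1)"

definition rotation_number :: "(real \<Rightarrow> real) \<Rightarrow> real \<Rightarrow> bool" where
  "rotation_number \<Phi> \<rho> \<longleftrightarrow> (\<lambda>n. ((\<Phi> ^^ n) 0) / real n) \<longlonglongrightarrow> \<rho>"

definition circle_map :: "(real \<Rightarrow> real) \<Rightarrow> real \<Rightarrow> real" where
  "circle_map \<Phi> x = frac (\<Phi> x)"

definition invariant_prob_measure :: "(real \<Rightarrow> real) \<Rightarrow> real measure \<Rightarrow> bool" where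
  "invariant_prob_measure \<Phi> \<mu> \<longleftrightarrow>
     prob_space \<mu> \<and> sets \<mu> = sets (restrict_space borel {0..<1}) \<and>
     circle_map \<Phi> \<in> measurable \<mu> \<mu> \<and> distr \<mu> \<mu> (circle_map \<Phi>) = \<mu>"

definition diophantine_type :: "real \<Rightarrow> real \<Rightarrow> bool" where
  "diophantine_type \<rho> r \<longleftrightarrow>
     (\<exists>C>0. \<forall>(p::int) (q::int). q > 0 \<longrightarrow> \<bar>\<rho> - real_of_int p / real_of_int q\<bar> \<ge> C / real_of_int q powr (1 + r))"

fun cf_rem :: "real \<Rightarrow> nat \<Rightarrow> real" where
  "cf_rem x 0 = x"
| "cf_rem x (Suc n) = 1 / frac (cf_rem x n)"

definition cf_quot :: "real \<Rightarrow> nat \<Rightarrow> int" where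
  "cf_quot x n = \<lfloor>cf_rem x n\<rfloor>"

fun cf_den :: "real \<Rightarrow> nat \<Rightarrow> int" where
  "cf_den x 0 = 1"
| "cf_den x (Suc 0) = cf_quot x 1"
| "cf_den x (Suc (Suc n)) = cf_quot x (Suc (Suc n)) * cf_den x (Suc n) + cf_den x n"

definition bounded_type :: "real \<Rightarrow> bool" where
  "bounded_type \<rho> \<longleftrightarrow> bdd_above (range (\<lambda>n. real_of_int (cf_den \<rho> (Suc n)) / real_of_int (cf_den \<rho> n)))"

definition slow_quotients :: "real \<Rightarrow> real \<Rightarrow> bool" where
  "slow_quotients \<rho> \<epsilon> \<longleftrightarrow> (\<forall>\<^sub>F m in sequentially. real_of_int (cf_quot \<rho> m) < real (m + 1) powr (1 + \<epsilon>))"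

definition curl_pt :: "(real \<Rightarrow> real) \<Rightarrow> real \<Rightarrow> nat \<Rightarrow> complex" where
  "curl_pt \<Phi> x0 n = (\<Sum>k<n. cis (2 * pi * (\<Phi> ^^ k) x0))"

text \<open>Polygonal curve through z_0, z_1, ...; consecutive points have distance 1, so this
  is its arc-length parametrisation on [0,\<infinity>).\<close>
definition curl_path :: "(real \<Rightarrow> real) \<Rightarrow> real \<Rightarrow> real \<Rightarrow> complex" where
  "curl_path \<Phi> x0 t =
     curl_pt \<Phi> x0 (nat \<lfloor>t\<rfloor>) + of_real (frac t) * (curl_pt \<Phi> x0 (Suc (nat \<lfloor>t\<rfloor>)) - curl_pt \<Phi> x0 (nat \<lfloor>t\<rfloor>))"

text \<open>Superficiality of a curve given by an arc-length parametrisation on [0,\<infinity>).\<close>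
definition superficial :: "(real \<Rightarrow> complex) \<Rightarrow> bool" where
  "superficial \<gamma> \<longleftrightarrow>
     (if bounded (\<gamma> ` {0..})
      then filterlim (\<lambda>\<epsilon>. measure lborel {y. \<exists>x\<in>\<gamma> ` {0..}. dist x y < \<epsilon>} / \<epsilon>) at_top (at_right 0)
      else filterlim (\<lambda>t. t / diameter (\<gamma> ` {0..t})) at_top at_top)"

end

theory Submission
  imports Defs "HOL-Number_Theory.Cong"
begin

text \<open>The limit superior \<open>H\<close> of \<open>\<Phi>\<^sup>n(x) - n\<rho>\<close> is a monotone semiconjugacy to the translation by \<open>\<rho>\<close>.
  If \<open>q\<close> is the denominator of a convergent of \<open>\<rho>\<close>, then \<open>H\<close> forces any two orbit segments of
  length \<open>q\<close>, sorted modulo 1, to interlace up to boundedly many steps, so the sums of a Lipschitz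
  function over them differ by a bounded amount. Averaging over one of the two starting points gives
  \<open>|z\<^sub>q - q v| \<le> 10\<pi>\<close>; writing \<open>n\<close> greedily in the \<open>q\<^sub>i\<close> bounds \<open>|z\<^sub>n - n v|\<close> by a multiple of
  \<open>n/q\<^sub>m + \<Sum>\<^bsub>i<m\<^esub> q\<^bsub>i+1\<^esub>/q\<^sub>i\<close> for \<open>q\<^sub>m \<le> n < q\<^bsub>m+1\<^esub>\<close>, and by \<open>o(n)\<close> uniformly in the starting
  point for every irrational \<open>\<rho>\<close>. If \<open>v = 0\<close> and the curve is bounded, it is superficial because
  the absence of periodic orbits provides arbitrarily many pairwise nonparallel unit segments, whose
  \<open>\<epsilon>\<close>-neighbourhoods overlap only in area \<open>O(\<epsilon>\<^sup>2)\<close>.\<close>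

section \<open>Continued fraction convergents\<close>

text \<open>Irrationality passes through \<open>frac\<close> and inversion, so the recursion for
  \<open>cf_rem\<close> never divides by zero.\<close>

lemma cf_rem_irrational:
  fixes x :: real
  assumes "x \<notin> \<rat>"
  shows "cf_rem x n \<notin> \<rat>"
proof (induction n)
  case (Suc n)
  have "frac (cf_rem x n) \<notin> \<rat>"
    by (metis Rats_add Rats_of_int Suc add.commute diff_add_cancel frac_def)
  then show ?case
    using Rats_inverse[of "1 / frac (cf_rem x n)"] by (auto simp: inverse_eq_divide)
qed (use assms in simp)

lemma cf_rem_Suc:
  fixes x :: real
  assumes "x \<notin> \<rat>"
  shows "(cf_rem x n - cf_quot x n) * cf_rem x (Suc n) = 1" "1 < cf_rem x (Suc n)"
proof -
  have "frac (cf_rem x n) \<noteq> 0"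
    using cf_rem_irrational[OF assms, of n] by (metis Ints_subset_Rats frac_eq_0_iff subsetD)
  then have "0 < frac (cf_rem x n)" "frac (cf_rem x n) < 1"
    using frac_ge_0[of "cf_rem x n"] frac_lt_1[of "cf_rem x n"] by linarith+
  then show "(cf_rem x n - cf_quot x n) * cf_rem x (Suc n) = 1" "1 < cf_rem x (Suc n)"
    by (simp_all add: cf_quot_def flip: frac_def)
qed

lemma cf_quot_ge_1: "(x :: real) \<notin> \<rat> \<Longrightarrow> 1 \<le> cf_quot x (Suc n)"
  using cf_rem_Suc(2)[of x n] by (simp add: cf_quot_def le_floor_iff del: cf_rem.simps)

lemma cf_den_pos:
  fixes x :: real
  assumes "x \<notin> \<rat>"
  shows "1 \<le> cf_den x n"
proof -
  have "1 \<le> cf_den x n \<and> 1 \<le> cf_den x (Suc n)"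
  proof (induction n)
    case 0
    then show ?case using cf_quot_ge_1[OF assms, of 0] by simp
  next
    case (Suc n)
    have "1 * 1 \<le> cf_quot x (Suc (Suc n)) * cf_den x (Suc n)"
      by (rule mult_mono) (use Suc cf_quot_ge_1[OF assms, of "Suc n"] in auto)
    then show ?case using Suc by simp
  qed
  then show ?thesis by simp
qed

lemma cf_den_Suc_ge:
  fixes x :: real
  assumes "x \<notin> \<rat>"
  shows "cf_den x n \<le> cf_den x (Suc n)"
proof (cases n)
  case 0
  then show ?thesis using cf_quot_ge_1[OF assms, of 0] by simp
next
  case (Suc k)
  have "1 * cf_den x (Suc k) \<le> cf_quot x (Suc (Suc k)) * cf_den x (Suc k)"
    by (rule mult_right_mono)
      (use cf_den_pos[OF assms, of "Suc k"] cf_quot_ge_1[OF assms, of "Suc k"] in auto)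
  then show ?thesis using cf_den_pos[OF assms, of k] Suc by simp
qed

lemma cf_den_Suc_Suc_ge:
  fixes x :: real
  assumes "x \<notin> \<rat>"
  shows "2 * cf_den x n \<le> cf_den x (Suc (Suc n))"
proof -
  have "1 * cf_den x (Suc n) \<le> cf_quot x (Suc (Suc n)) * cf_den x (Suc n)"
    by (rule mult_right_mono)
      (use cf_den_pos[OF assms, of "Suc n"] cf_quot_ge_1[OF assms, of "Suc n"] in auto)
  then show ?thesis using cf_den_Suc_ge[OF assms, of n] by simp
qed

text \<open>The lower-order term of the recursion is at most one more copy of
  \<open>cf_den x n\<close>. This turns bounds on partial quotients into bounds on ratios of
  consecutive denominators.\<close>

lemma cf_den_Suc_le:
  fixes x :: real
  assumes "x \<notin> \<rat>"
  shows "cf_den x (Suc n) \<le> (cf_quot x (Suc n) + 1) * cf_den x n"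
proof (cases n)
  case (Suc k)
  then show ?thesis using cf_den_Suc_ge[OF assms, of k] by (simp add: algebra_simps)
qed simp

lemma cf_den_mono: "(x :: real) \<notin> \<rat> \<Longrightarrow> m \<le> n \<Longrightarrow> cf_den x m \<le> cf_den x n"
  by (rule lift_Suc_mono_le) (rule cf_den_Suc_ge)

text \<open>Doubling every two steps is weaker than Fibonacci growth but already makes the index
  logarithmic in the denominator.\<close>

lemma cf_den_ge_power:
  fixes x :: real
  assumes "x \<notin> \<rat>"
  shows "2 ^ (n div 2) \<le> cf_den x n"
proof (induction n rule: less_induct)
  case (less n)
  consider "n = 0" | "n = 1" | k where "n = Suc (Suc k)"
    by (metis One_nat_def old.nat.exhaust)
  then show ?case
  proof cases
    case 3
    then show ?thesis using less[of k] cf_den_Suc_Suc_ge[OF assms, of k] by simp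
  qed (use cf_den_pos[OF assms, of n] in auto)
qed

section \<open>Numerators of the convergents and quality of approximation\<close>

fun cf_num :: "real \<Rightarrow> nat \<Rightarrow> int" where
  "cf_num x 0 = cf_quot x 0"
| "cf_num x (Suc 0) = cf_quot x 1 * cf_quot x 0 + 1"
| "cf_num x (Suc (Suc n)) = cf_quot x (Suc (Suc n)) * cf_num x (Suc n) + cf_num x n"

text \<open>Each step of the recursion multiplies the matrix of two consecutive convergents by a
  matrix of determinant -1.\<close>

lemma cf_det: "cf_num x (Suc n) * cf_den x n - cf_num x n * cf_den x (Suc n) = (-1) ^ n"
  by (induction n) (auto simp: algebra_simps)

lemma coprime_cf: "coprime (cf_num x n) (cf_den x n)"
proof (rule coprimeI)
  fix d assume "d dvd cf_num x n" "d dvd cf_den x n"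
  then have "d dvd (-1) ^ n"
    unfolding cf_det[of x n, symmetric] by simp
  then show "is_unit d"
    by (metis dvd_trans is_unit_power_iff minus_dvd_iff one_dvd dvd_refl)
qed

text \<open>Replacing the last partial quotient by the complete quotient \<open>cf_rem\<close> in
  the convergent recursion recovers \<open>x\<close> exactly. With denominators cleared, the
  induction step is a polynomial identity.\<close>

lemma cf_rem_convergents:
  fixes x :: real
  assumes "x \<notin> \<rat>"
  shows "x * (cf_rem x (Suc (Suc n)) * cf_den x (Suc n) + cf_den x n) =
    cf_rem x (Suc (Suc n)) * cf_num x (Suc n) + cf_num x n"
proof (induction n)
  case 0
  have 1: "(x - cf_quot x 0) * cf_rem x (Suc 0) = 1"
    using cf_rem_Suc(1)[OF assms, of 0] by (simp only: cf_rem.simps(1))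
  have 2: "(cf_rem x (Suc 0) - cf_quot x 1) * cf_rem x (Suc (Suc 0)) = 1"
    using cf_rem_Suc(1)[OF assms, of "Suc 0"] by (simp del: cf_rem.simps)
  show ?case
    using 1 2 by (simp del: cf_rem.simps) algebra
next
  case (Suc n)
  have 1: "(cf_rem x (Suc (Suc n)) - cf_quot x (Suc (Suc n))) * cf_rem x (Suc (Suc (Suc n))) = 1"
    using cf_rem_Suc(1)[OF assms] by blast
  show ?case
    using 1 Suc by (simp del: cf_rem.simps) algebra
qed

text \<open>By \<open>cf_rem_convergents\<close> the error times \<open>?d\<close> is plus or minus
  the determinant 1, and \<open>?d\<close> is at least the next denominator because
  \<open>cf_quot\<close> is the floor of \<open>cf_rem\<close>. Index 0 is separate since that
  identity starts with the indices 0 and 1.\<close>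

lemma cf_approx:
  fixes x :: real
  assumes "x \<notin> \<rat>"
  shows "\<bar>cf_den x n * x - cf_num x n\<bar> * cf_den x (Suc n) \<le> 1"
proof (cases n)
  case 0
  have 1: "(x - cf_quot x 0) * cf_rem x (Suc 0) = 1"
    using cf_rem_Suc(1)[OF assms, of 0] by (simp only: cf_rem.simps(1))
  have "0 \<le> x - cf_quot x 0" "cf_quot x 1 \<le> cf_rem x (Suc 0)"
    by (auto simp: cf_quot_def simp del: cf_rem.simps) (simp)
  then show ?thesis
    using 1 mult_left_mono[of "cf_quot x 1" "cf_rem x (Suc 0)" "x - cf_quot x 0"] 0
    by (simp del: cf_rem.simps)
next
  case (Suc k)
  let ?r = "cf_rem x (Suc (Suc k))"
  let ?e = "cf_den x (Suc k) * x - cf_num x (Suc k)"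
  let ?d = "?r * cf_den x (Suc k) + cf_den x k"
  have "?e * ?d = cf_num x k * cf_den x (Suc k) - cf_num x (Suc k) * cf_den x k"
    using cf_rem_convergents[OF assms, of k] by (simp del: cf_rem.simps) algebra
  also have "\<dots> = real_of_int (- ((-1) ^ k))"
    unfolding cf_det[of x k, symmetric] by simp
  finally have "\<bar>?e * ?d\<bar> = 1" by simp
  moreover have "cf_den x (Suc (Suc k)) \<le> ?d"
    using cf_den_pos[OF assms, of "Suc k"]
    by (auto simp: cf_quot_def simp del: cf_rem.simps intro!: mult_right_mono)
  moreover have "0 \<le> real_of_int (cf_den x (Suc (Suc k)))"
    using cf_den_pos[OF assms, of "Suc (Suc k)"] by linarith
  ultimately show ?thesis
    using mult_left_mono[of "cf_den x (Suc (Suc k))" "?d" "\<bar>?e\<bar>"] Suc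
    by (simp add: abs_mult del: cf_rem.simps cf_den.simps)
qed

lemma cf_den_index_le_ln:
  fixes x :: real
  assumes "x \<notin> \<rat>" "cf_den x m \<le> int n"
  shows "real m \<le> 4 * ln (real n) + 1"
proof -
  have "(2::int) ^ (m div 2) \<le> int n"
    using cf_den_ge_power[OF assms(1), of m] assms(2) by linarith
  then have "real_of_int (2 ^ (m div 2)) \<le> real_of_int (int n)"
    by (simp only: of_int_le_iff)
  then have *: "2 ^ (m div 2) \<le> real n" by simp
  then have "ln (2 ^ (m div 2)) \<le> ln (real n)"
    by (rule ln_mono) auto
  then have "real (m div 2) * ln 2 \<le> ln (real n)"
    by (simp add: ln_realpow)
  \<comment> \<open>The crude lower bound 1/2 for \<open>ln 2\<close> yields the constant 4, and the
    parity of \<open>m\<close> the summand 1.\<close>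
  moreover have "real (m div 2) * (1/2) \<le> real (m div 2) * ln 2"
    by (rule mult_left_mono) (use ln2_ge_two_thirds in auto)
  moreover have "real m \<le> 2 * real (m div 2) + 1"
    by linarith
  ultimately show ?thesis by linarith
qed

section \<open>The semiconjugacy to a rotation\<close>

lemma lift_funpow:
  assumes "circle_homeo_lift \<Phi>"
  shows "mono (\<Phi> ^^ n)" "(\<Phi> ^^ n) (x + of_int m) = (\<Phi> ^^ n) x + of_int m"
proof -
  show "mono (\<Phi> ^^ n)"
    using assms by (intro mono_pow) (simp add: circle_homeo_lift_def strict_mono_mono)
  have *: "(\<Phi> ^^ n) (x + 1) = (\<Phi> ^^ n) x + 1" for x
    using assms by (induction n) (auto simp: circle_homeo_lift_def)
  have nat: "(\<Phi> ^^ n) (x + real k) = (\<Phi> ^^ n) x + real k" for k x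
  proof (induction k)
    case (Suc k)
    show ?case using *[of "x + real k"] Suc by (simp add: algebra_simps)
  qed simp
  show "(\<Phi> ^^ n) (x + of_int m) = (\<Phi> ^^ n) x + of_int m"
  proof (cases m rule: int_cases2)
    case (nonneg k)
    then show ?thesis using nat by simp
  next
    case (nonpos k)
    then show ?thesis using nat[of "x - real k" k] by simp
  qed
qed

text \<open>Replacing \<open>y\<close> by its first integer translate at or above \<open>x\<close>
  and using monotonicity loses less than 1.\<close>

lemma lift_displacement_diff:
  assumes "circle_homeo_lift \<Phi>"
  shows "((\<Phi> ^^ n) x - x) - ((\<Phi> ^^ n) y - y) \<le> 1"
proof -
  let ?m = "\<lceil>x - y\<rceil>"
  have "(\<Phi> ^^ n) x \<le> (\<Phi> ^^ n) (y + of_int ?m)"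
    using lift_funpow(1)[OF assms, of n] by (rule monoD) linarith
  then show ?thesis
    unfolding lift_funpow(2)[OF assms] by linarith
qed

text \<open>In an orbit of length \<open>k * n\<close> cut into \<open>k\<close> blocks, every block
  displacement is within 1 of the one at \<open>x\<close>. Their average tends to
  \<open>n * \<rho>\<close>, so the error stays 1 however large \<open>n\<close> is.\<close>

lemma lift_displacement_bound:
  assumes lift: "circle_homeo_lift \<Phi>" and rot: "rotation_number \<Phi> \<rho>"
  shows "\<bar>(\<Phi> ^^ n) x - x - real n * \<rho>\<bar> \<le> 1"
proof (cases "n = 0")
  case False
  let ?\<psi> = "(\<Phi> ^^ n) x - x"
  have bound: "\<bar>(\<Phi> ^^ (k * n)) 0 - real k * ?\<psi>\<bar> \<le> real k" for k
  proof (induction k)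
    case (Suc k)
    define z where "z = (\<Phi> ^^ (k * n)) 0"
    have "(\<Phi> ^^ (Suc k * n)) 0 = (\<Phi> ^^ n) z"
      by (simp add: funpow_add z_def)
    then show ?case
      using Suc lift_displacement_diff[OF lift, of n x z] lift_displacement_diff[OF lift, of n z x]
      by (simp add: algebra_simps z_def[symmetric])
  qed simp
  \<comment> \<open>\<open>Suc k\<close> keeps the divisor positive along the multiples of
    \<open>n\<close>.\<close>
  have "filterlim (\<lambda>k. Suc k * n) at_top sequentially"
    by (rule filterlim_at_top_mono[OF filterlim_Suc])
      (use False in \<open>auto intro!: always_eventually mult_le_mono2[of 1 n, simplified] simp del: mult_Suc\<close>)
  then have "(\<lambda>k. (\<Phi> ^^ (Suc k * n)) 0 / real (Suc k * n)) \<longlonglongrightarrow> \<rho>"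
    using rot unfolding rotation_number_def by (rule filterlim_compose[rotated])
  then have "(\<lambda>k. \<bar>(\<Phi> ^^ (Suc k * n)) 0 / real (Suc k * n) * real n - ?\<psi>\<bar>) \<longlonglongrightarrow> \<bar>\<rho> * real n - ?\<psi>\<bar>"
    by (intro tendsto_intros)
  moreover have "\<bar>(\<Phi> ^^ (Suc k * n)) 0 / real (Suc k * n) * real n - ?\<psi>\<bar> \<le> 1" for k
  proof -
    have "(\<Phi> ^^ (Suc k * n)) 0 / real (Suc k * n) * real n - ?\<psi> =
        ((\<Phi> ^^ (Suc k * n)) 0 - real (Suc k) * ?\<psi>) / real (Suc k)"
      using False by (simp add: diff_divide_distrib del: of_nat_Suc mult_Suc funpow.simps)
    then show ?thesis
      using bound[of "Suc k"] by (simp add: abs_divide divide_le_eq del: mult_Suc funpow.simps)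
  qed
  ultimately have "\<bar>\<rho> * real n - ?\<psi>\<bar> \<le> 1"
    by (intro LIMSEQ_le_const2) auto
  then show ?thesis by (simp add: algebra_simps abs_minus_commute)
qed simp

text \<open>The sequence \<open>u x\<close> stays within 1 of \<open>x\<close>, so its upper limit
  is finite; upper limits keep pointwise inequalities and ignore index shifts, which gives
  monotonicity and both equivariances.\<close>

lemma lift_semiconjugacy:
  assumes lift: "circle_homeo_lift \<Phi>" and rot: "rotation_number \<Phi> \<rho>"
  obtains H :: "real \<Rightarrow> real"
  where "mono H" "\<And>x m. H (x + of_int m) = H x + of_int m" "\<And>x. H (\<Phi> x) = H x + \<rho>"
proof -
  define u where "u x n = ereal ((\<Phi> ^^ n) x - real n * \<rho>)" for x n
  define H where "H x = real_of_ereal (limsup (u x))" for x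
  have u_bounds: "ereal (x - 1) \<le> u x n" "u x n \<le> ereal (x + 1)" for x n
    using lift_displacement_bound[OF lift rot, of n x] by (auto simp: u_def abs_le_iff)
  have "ereal (x - 1) \<le> limsup (u x)" "limsup (u x) \<le> ereal (x + 1)" for x
    using u_bounds by (auto intro!: le_Limsup Limsup_bounded)
  then have fin: "\<bar>limsup (u x)\<bar> \<noteq> \<infinity>" for x
    by (metis MInfty_neq_ereal(1) PInfty_neq_ereal(1) abs_ereal.elims ereal_infty_less_eq(1,2) order_antisym_conv)
  have lim_H: "limsup (u x) = ereal (H x)" for x
    using fin by (simp add: H_def ereal_real)
  \<comment> \<open>Integer translation is the case \<open>k = 0\<close>; one step of
    \<open>\<Phi>\<close> is the case \<open>k = 1\<close>, because
    \<open>u (\<Phi> x) n = u x (n + 1) + \<rho>\<close>.\<close>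
  have shift: "H y = H x + c" if "\<And>n. u y n = u x (n + k) + ereal c" for x y c k
  proof -
    have "limsup (u y) = limsup (\<lambda>n. u x (n + k) + ereal c)"
      using that by presburger
    also have "\<dots> = limsup (\<lambda>n. u x (n + k)) + ereal c"
      by (rule Limsup_add_ereal_right) auto
    also have "limsup (\<lambda>n. u x (n + k)) = limsup (u x)"
      by (rule limsup_shift_k)
    finally show ?thesis by (simp add: lim_H)
  qed
  show thesis
  proof
    show "mono H"
    proof
      fix x y :: real assume "x \<le> y"
      then have "u x n \<le> u y n" for n
        using lift_funpow(1)[OF lift, of n] by (simp add: u_def monoD)
      then have "limsup (u x) \<le> limsup (u y)"
        by (intro Limsup_mono) auto
      then show "H x \<le> H y" by (simp add: lim_H)
    qed
    show "H (x + of_int m) = H x + of_int m" for x m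
      by (rule shift[of _ _ 0]) (simp add: u_def lift_funpow(2)[OF lift])
    show "H (\<Phi> x) = H x + \<rho>" for x
      by (rule shift[of _ _ 1]) (simp add: u_def funpow_swap1 algebra_simps)
  qed
qed

lemma semiconjugacy_funpow:
  fixes H :: "real \<Rightarrow> real"
  assumes "\<And>x. H (\<Phi> x) = H x + \<rho>"
  shows "H ((\<Phi> ^^ n) x) = H x + real n * \<rho>"
  using assms by (induction n) (auto simp: algebra_simps)

text \<open>Under \<open>H\<close> a coincidence of two orbit points modulo 1 makes
  \<open>(k - l) * \<rho>\<close> an integer, hence \<open>\<rho>\<close> rational unless
  \<open>k = l\<close>.\<close>

lemma lift_orbit_aperiodic:
  assumes lift: "circle_homeo_lift \<Phi>" and rot: "rotation_number \<Phi> \<rho>" and irr: "\<rho> \<notin> \<rat>"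
    and eq: "(\<Phi> ^^ k) x - (\<Phi> ^^ l) x \<in> \<int>"
  shows "k = l"
proof (rule ccontr)
  assume "k \<noteq> l"
  obtain H where H: "mono H" "\<And>x m. H (x + of_int m) = H x + of_int m" "\<And>x. H (\<Phi> x) = H x + \<rho>"
    using lift_semiconjugacy[OF lift rot] by metis
  obtain m where "(\<Phi> ^^ k) x = (\<Phi> ^^ l) x + of_int m"
    using eq by (elim Ints_cases) (simp add: algebra_simps)
  then have "H x + real k * \<rho> = H x + real l * \<rho> + of_int m"
    using H(2) semiconjugacy_funpow[of H \<Phi>, OF H(3)] by metis
  then have "\<rho> = of_int m / (real k - real l)"
    using \<open>k \<noteq> l\<close> by (simp add: field_simps)
  then show False
    using irr by simp
qed

section \<open>A Denjoy--Koksma inequality\<close>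

text \<open>Moving the window by one drops a term and adds its translate by a period, a gain of
  \<open>c\<close>. The case \<open>c = 0\<close> reindexes sums of a periodic function, the case
  \<open>c = 1\<close> evaluates total gaps.\<close>

lemma sum_shift_quasiperiodic:
  fixes X :: "int \<Rightarrow> 'a :: comm_ring_1"
  assumes X: "\<And>j. X (j + int q) = X j + c"
  shows "(\<Sum>i<q. X (int i + s)) = (\<Sum>i<q. X (int i)) + c * of_int s"
proof -
  have step: "(\<Sum>i<q. X (int i + (s + 1))) = (\<Sum>i<q. X (int i + s)) + c" for s
  proof -
    have "(\<Sum>i<q. X (int i + s)) + X (int q + s) = (\<Sum>i<Suc q. X (int i + s))"
      by simp
    also have "\<dots> = X s + (\<Sum>i<q. X (int i + (s + 1)))"
      by (subst sum.lessThan_Suc_shift) (simp add: algebra_simps)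
    finally show ?thesis
      using X[of s] by (simp add: algebra_simps)
  qed
  show ?thesis
  proof (induction s rule: int_induct[of _ 0])
    case (step1 i)
    then show ?case unfolding step by (simp add: algebra_simps)
  next
    case (step2 i)
    then show ?case using step[of "i - 1"] by (simp add: algebra_simps)
  qed simp
qed

text \<open>Sorting the first \<open>q\<close> points of an orbit together with their integer translates gives an
  increasing sequence \<open>X\<close>: its \<open>j\<close>-th point is the translate of \<open>\<Phi>\<^sup>k z\<close> with \<open>k p \<equiv> j (mod q)\<close>
  whose \<open>H\<close>-value is within \<open>1/q\<close> of \<open>H z + j/q\<close>.\<close>

lemma sorted_orbit:
  fixes H :: "real \<Rightarrow> real" and f :: "real \<Rightarrow> 'a :: comm_monoid_add"
  assumes H_int: "\<And>x m. H (x + of_int m) = H x + of_int m"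
    and H_\<Phi>: "\<And>x. H (\<Phi> x) = H x + \<rho>"
    and q: "0 < q" and cop: "coprime p (int q)" and approx: "\<bar>real q * \<rho> - of_int p\<bar> * real q \<le> 1"
    and per: "\<And>x m. f (x + of_int m) = f x"
  obtains X :: "int \<Rightarrow> real" where "\<And>j. X (j + int q) = X j + 1"
    "\<And>j. \<bar>real q * H (X j) - real q * H z - of_int j\<bar> < 1"
    "(\<Sum>i<q. f (X (int i))) = (\<Sum>k<q. f ((\<Phi> ^^ k) z))"
proof -
  \<comment> \<open>\<open>u\<close> inverts \<open>p\<close> modulo \<open>q\<close>, so the orbit
    index belonging to position \<open>j\<close> is \<open>j * u\<close> modulo
    \<open>q\<close>.\<close>
  obtain u where u: "[p * u = 1] (mod int q)"
    using cong_solve_coprime_int[OF cop] by auto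
  define k where "k j = nat ((j * u) mod int q)" for j
  define X where "X j = (\<Phi> ^^ k j) z + of_int ((j - int (k j) * p) div int q)" for j
  have int_k: "int (k j) = (j * u) mod int q" for j
    using q by (simp add: k_def)
  have k_less: "k j < q" for j
    using q by (simp add: k_def nat_less_iff)
  have kp: "[int (k j) * p = j] (mod int q)" for j
  proof -
    have "[int (k j) * p = j * u * p] (mod int q)"
      unfolding int_k by (intro cong_scalar_right cong_mod_left) simp
    also have "[j * u * p = j * 1] (mod int q)"
      using cong_scalar_left[OF u, of j] by (simp add: mult_ac)
    finally show ?thesis by simp
  qed
  then have dvd: "int q dvd j - int (k j) * p" for j
    by (simp add: cong_iff_dvd_diff dvd_diff_commute)
  show thesis
  proof
    show "X (j + int q) = X j + 1" for j
    proof -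
      have k_eq: "k (j + int q) = k j"
        by (simp add: k_def distrib_right)
      have "(j + int q - int (k j) * p) div int q = (j - int (k j) * p) div int q + 1"
        using q div_add_self2[of "int q" "j - int (k j) * p"] by (simp add: algebra_simps)
      then show ?thesis
        unfolding X_def k_eq by simp
    qed
    show "\<bar>real q * H (X j) - real q * H z - of_int j\<bar> < 1" for j
    proof -
      have "real q * of_int ((j - int (k j) * p) div int q) = of_int (int q * ((j - int (k j) * p) div int q))"
        by simp
      also have "int q * ((j - int (k j) * p) div int q) = j - int (k j) * p"
        using dvd by simp
      \<comment> \<open>What remains is the scaled error of \<open>p / q\<close> accumulated over
        \<open>k j < q\<close> steps, each contributing at most \<open>1 / q\<close>.\<close>
      finally have "real q * H (X j) - real q * H z - of_int j = real (k j) * (real q * \<rho> - of_int p)"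
        unfolding X_def H_int semiconjugacy_funpow[of H \<Phi>, OF H_\<Phi>] by (simp add: algebra_simps)
      moreover have "real (k j) * \<bar>real q * \<rho> - of_int p\<bar> < 1"
      proof (cases "real q * \<rho> - of_int p = 0")
        case False
        then have "real (k j) * \<bar>real q * \<rho> - of_int p\<bar> < real q * \<bar>real q * \<rho> - of_int p\<bar>"
          using k_less by (intro mult_strict_right_mono) auto
        then show ?thesis using approx by (simp add: mult.commute)
      qed simp
      ultimately show ?thesis by (simp add: abs_mult)
    qed
    \<comment> \<open>Multiplication by \<open>p\<close> and by \<open>u\<close> modulo
      \<open>q\<close> are mutually inverse, so positions and orbit indices correspond
      bijectively.\<close>
    have k_inj: "k ((int i * p) mod int q) = i" if "i < q" for i
    proof -
      have "[int (k ((int i * p) mod int q)) = (int i * p) * u] (mod int q)"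
        unfolding int_k by (simp add: cong_def mod_mult_left_eq)
      also have "[(int i * p) * u = int i * 1] (mod int q)"
        using cong_scalar_left[OF u, of "int i"] by (simp add: mult_ac)
      finally have "[k ((int i * p) mod int q) = i] (mod q)"
        by (simp add: cong_int_iff)
      then show ?thesis
        using k_less that by (simp add: cong_def)
    qed
    have "(\<Sum>i<q. f (X (int i))) = (\<Sum>i<q. f ((\<Phi> ^^ k (int i)) z))"
      by (simp add: X_def per)
    also have "\<dots> = (\<Sum>k<q. f ((\<Phi> ^^ k) z))"
    proof (rule sum.reindex_bij_witness[where i = "\<lambda>i. nat ((int i * p) mod int q)" and j = "\<lambda>i. k (int i)"])
      fix a assume "a \<in> {..<q}"
      then show "nat (int (k (int a)) * p mod int q) = a"
        using kp[of "int a"] by (simp add: cong_def)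
      show "k (int a) \<in> {..<q}" using k_less by simp
    next
      fix b assume b: "b \<in> {..<q}"
      then show "k (int (nat (int b * p mod int q))) = b" "nat (int b * p mod int q) \<in> {..<q}"
        using k_inj[of b] q by (auto simp: nat_less_iff)
    qed simp
    finally show "(\<Sum>i<q. f (X (int i))) = (\<Sum>k<q. f ((\<Phi> ^^ k) z))" .
  qed
qed

text \<open>Sorting both orbit segments by \<open>H\<close> and offsetting them by \<open>s\<close>
  pairs points that share five consecutive gaps of \<open>X\<close>. The gaps of one period add up
  to 1, so the paired distances total at most 5, independently of \<open>q\<close>.\<close>

lemma Denjoy_Koksma:
  fixes f :: "real \<Rightarrow> complex"
  assumes lift: "circle_homeo_lift \<Phi>" and rot: "rotation_number \<Phi> \<rho>"
    and q: "0 < q" "coprime p (int q)" "\<bar>real q * \<rho> - of_int p\<bar> * real q \<le> 1"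
    and per: "\<And>x m. f (x + of_int m) = f x"
    and lip: "\<And>x y. norm (f x - f y) \<le> L * \<bar>x - y\<bar>" and L: "0 \<le> L"
  shows "norm ((\<Sum>k<q. f ((\<Phi> ^^ k) x)) - (\<Sum>k<q. f ((\<Phi> ^^ k) y))) \<le> 5 * L"
proof -
  obtain H where H: "mono H" "\<And>x m. H (x + of_int m) = H x + of_int m" "\<And>x. H (\<Phi> x) = H x + \<rho>"
    using lift_semiconjugacy[OF lift rot] by metis
  obtain X where X: "\<And>j. X (j + int q) = X j + 1"
    "\<And>j. \<bar>real q * H (X j) - real q * H x - of_int j\<bar> < 1"
    "(\<Sum>i<q. f (X (int i))) = (\<Sum>k<q. f ((\<Phi> ^^ k) x))"
    using sorted_orbit[OF H(2,3) q per] by metis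
  obtain Y where Y: "\<And>j. Y (j + int q) = Y j + 1"
    "\<And>j. \<bar>real q * H (Y j) - real q * H y - of_int j\<bar> < 1"
    "(\<Sum>i<q. f (Y (int i))) = (\<Sum>k<q. f ((\<Phi> ^^ k) y))"
    using sorted_orbit[OF H(2,3) q per] by metis
  define s where "s = \<lfloor>real q * H y - real q * H x\<rfloor>"
  have less: "a < b" if "real q * H a < real q * H b" for a b
    using that q(1) monoD[OF H(1), of b a] by (force simp: not_less[symmetric])
  have s: "of_int s \<le> real q * H y - real q * H x" "real q * H y - real q * H x < of_int s + 1"
    by (simp_all add: s_def)
  \<comment> \<open>Each \<open>H\<close>-value, scaled by \<open>q\<close>, is off by less than 1,
    and rounding to \<open>s\<close> loses less than 1 more on one side; the offsets -2 and 3
    therefore enclose both points.\<close>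
  have close: "norm (f (X (int i + s)) - f (Y (int i))) \<le> L * (X (int i + (s + 3)) - X (int i + (s - 2)))" for i
  proof -
    let ?a = "X (int i + (s - 2))" and ?b = "X (int i + (s + 3))"
    have "?a < X (int i + s)" "X (int i + s) < ?b"
      by (rule less; use X(2)[of "int i + (s - 2)"] X(2)[of "int i + s"] X(2)[of "int i + (s + 3)"]
        in \<open>simp add: abs_less_iff\<close>)+
    moreover have "?a < Y (int i)" "Y (int i) < ?b"
      by (rule less; use X(2)[of "int i + (s - 2)"] Y(2)[of "int i"] X(2)[of "int i + (s + 3)"] s
        in \<open>simp add: abs_less_iff\<close>)+
    ultimately have "\<bar>X (int i + s) - Y (int i)\<bar> \<le> ?b - ?a"
      by linarith
    then show ?thesis
      using lip[of "X (int i + s)" "Y (int i)"] L by (meson mult_left_mono order_trans)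
  qed
  have fX: "f (X (j + int q)) = f (X j) + 0" for j
    using per[of "X j" 1] by (simp add: X(1))
  have "(\<Sum>k<q. f ((\<Phi> ^^ k) x)) - (\<Sum>k<q. f ((\<Phi> ^^ k) y)) =
      (\<Sum>i<q. f (X (int i + s)) - f (Y (int i)))"
    using sum_shift_quasiperiodic[of "\<lambda>j. f (X j)", OF fX, of s] by (simp add: sum_subtractf X(3) Y(3))
  also have "norm \<dots> \<le> (\<Sum>i<q. L * (X (int i + (s + 3)) - X (int i + (s - 2))))"
    using close by (intro sum_norm_le) auto
  also have "\<dots> = L * ((\<Sum>i<q. X (int i + (s + 3))) - (\<Sum>i<q. X (int i + (s - 2))))"
    by (simp only: sum_subtractf sum_distrib_left[symmetric])
  also have "\<dots> = 5 * L"
    using sum_shift_quasiperiodic[of X, OF X(1), of "s + 3"] sum_shift_quasiperiodic[of X, OF X(1), of "s - 2"]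
    by simp
  finally show ?thesis .
qed

section \<open>Exponential sums along orbits\<close>

definition orbit_discrepancy :: "(real \<Rightarrow> real) \<Rightarrow> complex \<Rightarrow> real \<Rightarrow> nat \<Rightarrow> real" where
  "orbit_discrepancy \<Phi> v x n = norm (curl_pt \<Phi> x n - of_nat n * v)"

text \<open>Cocycle identity: a later block is again an orbit sum, from a moved starting point.
  Bounds uniform in the starting point can therefore be added over blocks.\<close>

lemma curl_pt_add: "curl_pt \<Phi> x (m + n) = curl_pt \<Phi> x m + curl_pt \<Phi> ((\<Phi> ^^ m) x) n"
  by (induction n) (simp_all add: curl_pt_def funpow_add add.commute[of m])

lemma norm_curl_pt_le: "norm (curl_pt \<Phi> x n) \<le> real n"
proof -
  have "norm (curl_pt \<Phi> x n) \<le> (\<Sum>k<n. 1)"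
    unfolding curl_pt_def by (rule sum_norm_le) simp
  then show ?thesis by simp
qed

lemma norm_cis_diff_le: "norm (cis a - cis b) \<le> \<bar>a - b\<bar>"
proof -
  have "cis a - cis b = cis b * (cis (a - b) - 1)"
    by (simp add: algebra_simps cis_mult)
  then have "norm (cis a - cis b) = norm (cis (a - b) - 1)"
    by (simp add: norm_mult)
  also have "\<dots> \<le> \<bar>a - b\<bar>"
    using iexp_approx1[of "a - b" 0] by (simp add: cis_conv_exp)
  finally show ?thesis .
qed

lemma cis_add_int: "cis (2 * pi * (x + of_int m)) = cis (2 * pi * x)"
proof -
  have "cis (2 * pi * (x + of_int m)) = cis (2 * pi * x) * cis (2 * pi * of_int m)"
    by (simp only: cis_mult distrib_left)
  also have "cis (2 * pi * of_int m) = 1"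
    by (rule cis_multiple_2pi) simp
  finally show ?thesis by simp
qed

section \<open>Orbit sums and the invariant measure\<close>

lemma invariant_integral:
  assumes inv: "invariant_prob_measure \<Phi> \<mu>" and g: "continuous_on UNIV g"
    and per: "\<And>x m. g (x + of_int m) = (g x :: complex)"
  shows "integral\<^sup>L \<mu> (\<lambda>x. g (\<Phi> x)) = integral\<^sup>L \<mu> g"
proof -
  have sets: "sets \<mu> = sets (restrict_space borel {0..<1})"
    and meas: "circle_map \<Phi> \<in> measurable \<mu> \<mu>" and distr: "distr \<mu> \<mu> (circle_map \<Phi>) = \<mu>"
    using inv by (auto simp: invariant_prob_measure_def)
  have g_meas: "g \<in> borel_measurable \<mu>"
    using borel_measurable_continuous_onI[OF g]
    by (subst measurable_cong_sets[OF sets refl]) (rule measurable_restrict_space1)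
  \<comment> \<open>\<open>\<mu>\<close> is preserved by the circle map, whereas \<open>g\<close> is
    composed with the lift; periodicity identifies the two compositions.\<close>
  have "g (\<Phi> x) = g (circle_map \<Phi> x)" for x
    using per[of "\<Phi> x" "- \<lfloor>\<Phi> x\<rfloor>"] by (simp add: circle_map_def frac_def)
  then have "integral\<^sup>L \<mu> (\<lambda>x. g (\<Phi> x)) = integral\<^sup>L (distr \<mu> \<mu> (circle_map \<Phi>)) g"
    using integral_distr[OF meas g_meas] by simp
  then show ?thesis unfolding distr .
qed

text \<open>By invariance every iterate contributes the same mean, so only the number of terms
  enters.\<close>

lemma
  assumes lift: "circle_homeo_lift \<Phi>" and inv: "invariant_prob_measure \<Phi> \<mu>"
  shows integrable_curl_pt: "integrable \<mu> (\<lambda>y. curl_pt \<Phi> y n)"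
    and integral_curl_pt:
      "integral\<^sup>L \<mu> (\<lambda>y. curl_pt \<Phi> y n) = of_nat n * integral\<^sup>L \<mu> (\<lambda>x. cis (2 * pi * x))"
proof -
  interpret prob_space \<mu> using inv by (simp add: invariant_prob_measure_def)
  have cont_\<Phi>: "continuous_on UNIV \<Phi>"
    using lift by (simp add: circle_homeo_lift_def)
  have cont_pow: "continuous_on UNIV (\<Phi> ^^ k)" for k
    by (induction k) (auto intro: continuous_on_compose2[OF cont_\<Phi>] simp: o_def)
  have cont: "continuous_on UNIV (\<lambda>x. cis (2 * pi * (\<Phi> ^^ k) x))" for k
    by (intro continuous_intros cont_pow)
  have sets: "sets \<mu> = sets (restrict_space borel {0..<1})"
    using inv by (simp add: invariant_prob_measure_def)
  have int: "integrable \<mu> (\<lambda>x. cis (2 * pi * (\<Phi> ^^ k) x))" for k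
  proof (rule integrable_const_bound[of _ 1])
    show "(\<lambda>x. cis (2 * pi * (\<Phi> ^^ k) x)) \<in> borel_measurable \<mu>"
      using borel_measurable_continuous_onI[OF cont]
      by (subst measurable_cong_sets[OF sets refl]) (rule measurable_restrict_space1)
  qed simp
  show "integrable \<mu> (\<lambda>y. curl_pt \<Phi> y n)"
    unfolding curl_pt_def by (intro Bochner_Integration.integrable_sum int)
  have eq: "integral\<^sup>L \<mu> (\<lambda>x. cis (2 * pi * (\<Phi> ^^ k) x)) = integral\<^sup>L \<mu> (\<lambda>x. cis (2 * pi * x))" for k
  proof (induction k)
    case (Suc k)
    have "integral\<^sup>L \<mu> (\<lambda>x. cis (2 * pi * (\<Phi> ^^ k) (\<Phi> x))) = integral\<^sup>L \<mu> (\<lambda>x. cis (2 * pi * (\<Phi> ^^ k) x))"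
      by (rule invariant_integral[OF inv cont]) (simp only: lift_funpow(2)[OF lift] cis_add_int)
    then show ?case using Suc by (simp add: funpow_swap1)
  qed simp
  show "integral\<^sup>L \<mu> (\<lambda>y. curl_pt \<Phi> y n) = of_nat n * integral\<^sup>L \<mu> (\<lambda>x. cis (2 * pi * x))"
    unfolding curl_pt_def by (subst Bochner_Integration.integral_sum[OF int]) (simp add: eq)
qed

section \<open>Discrepancy along denominators of convergents\<close>

context
  fixes \<Phi> :: "real \<Rightarrow> real" and \<rho> :: real and \<mu> :: "real measure" and v :: complex
  assumes lift: "circle_homeo_lift \<Phi>"
    and rot: "rotation_number \<Phi> \<rho>"
    and irr: "\<rho> \<notin> \<rat>"
    and inv: "invariant_prob_measure \<Phi> \<mu>"
    and v: "v = integral\<^sup>L \<mu> (\<lambda>x. cis (2 * pi * x))"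
begin

abbreviation "D \<equiv> orbit_discrepancy \<Phi> v"

abbreviation "qd m \<equiv> nat (cf_den \<rho> m)"

lemma int_qd: "int (qd m) = cf_den \<rho> m" and qd_pos: "0 < qd m"
  using cf_den_pos[OF irr, of m] by auto

lemma norm_mean_le_1: "norm v \<le> 1"
proof -
  interpret prob_space \<mu> using inv by (simp add: invariant_prob_measure_def)
  have "norm v \<le> (\<integral>x. norm (cis (2 * pi * x)) \<partial>\<mu>)"
    unfolding v by (rule integral_norm_bound)
  then show ?thesis by (simp add: prob_space)
qed

lemma discrepancy_le: "D x n \<le> 2 * real n"
proof -
  have "norm (of_nat n * v) \<le> real n"
    using norm_mean_le_1 by (simp add: norm_mult mult_left_le)
  then show ?thesis
    unfolding orbit_discrepancy_def
    using norm_curl_pt_le[of \<Phi> x n] norm_triangle_ineq4[of "curl_pt \<Phi> x n" "of_nat n * v"] by linarith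
qed

lemma discrepancy_add: "D x (m + n) \<le> D x m + D ((\<Phi> ^^ m) x) n"
proof -
  have "curl_pt \<Phi> x (m + n) - of_nat (m + n) * v =
      (curl_pt \<Phi> x m - of_nat m * v) + (curl_pt \<Phi> ((\<Phi> ^^ m) x) n - of_nat n * v)"
    by (simp add: curl_pt_add algebra_simps)
  then show ?thesis
    unfolding orbit_discrepancy_def by (metis norm_triangle_ineq)
qed

text \<open>\<open>qd m\<close> times \<open>v\<close> is the mean over \<open>y\<close> of the
  orbit sums from \<open>y\<close>, so the bound of \<open>Denjoy_Koksma\<close> for a pair
  \<open>x\<close>, \<open>y\<close> can be averaged over \<open>y\<close>. The constant is 5 times
  the Lipschitz constant \<open>2 * pi\<close>.\<close>

lemma discrepancy_qd: "D x (qd m) \<le> 10 * pi"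
proof -
  interpret prob_space \<mu> using inv by (simp add: invariant_prob_measure_def)
  have "norm (curl_pt \<Phi> x (qd m) - curl_pt \<Phi> y (qd m)) \<le> 5 * (2 * pi)" for y
    unfolding curl_pt_def
  proof (rule Denjoy_Koksma[OF lift rot qd_pos, where p = "cf_num \<rho> m" and f = "\<lambda>x. cis (2 * pi * x)"])
    show "coprime (cf_num \<rho> m) (int (qd m))"
      unfolding int_qd by (rule coprime_cf)
    have qd: "real (qd m) = cf_den \<rho> m"
      by (metis int_qd of_int_of_nat_eq)
    \<comment> \<open>\<open>Denjoy_Koksma\<close> asks for the current denominator;
      \<open>cf_approx\<close> is sharper, with the next one.\<close>
    have "\<bar>cf_den \<rho> m * \<rho> - cf_num \<rho> m\<bar> * cf_den \<rho> m \<le> \<bar>cf_den \<rho> m * \<rho> - cf_num \<rho> m\<bar> * cf_den \<rho> (Suc m)"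
      using cf_den_Suc_ge[OF irr, of m] by (intro mult_left_mono) auto
    then show "\<bar>real (qd m) * \<rho> - of_int (cf_num \<rho> m)\<bar> * real (qd m) \<le> 1"
      unfolding qd using cf_approx[OF irr, of m] by linarith
    show "norm (cis (2 * pi * a) - cis (2 * pi * b)) \<le> 2 * pi * \<bar>a - b\<bar>" for a b
    proof -
      have "\<bar>2 * pi * a - 2 * pi * b\<bar> = 2 * pi * \<bar>a - b\<bar>"
        by (simp add: abs_mult flip: right_diff_distrib)
      then show ?thesis using norm_cis_diff_le[of "2 * pi * a" "2 * pi * b"] by simp
    qed
  qed (use cis_add_int in auto)
  then have *: "norm (curl_pt \<Phi> x (qd m) - curl_pt \<Phi> y (qd m)) \<le> 10 * pi" for y
    by (simp add: algebra_simps)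
  have "curl_pt \<Phi> x (qd m) - of_nat (qd m) * v = (\<integral>y. curl_pt \<Phi> x (qd m) - curl_pt \<Phi> y (qd m) \<partial>\<mu>)"
    using integrable_curl_pt[OF lift inv] integral_curl_pt[OF lift inv]
    by (subst Bochner_Integration.integral_diff) (simp_all add: v prob_space)
  also have "norm \<dots> \<le> (\<integral>y. norm (curl_pt \<Phi> x (qd m) - curl_pt \<Phi> y (qd m)) \<partial>\<mu>)"
    by (rule integral_norm_bound)
  also have "\<dots> \<le> (\<integral>y. 10 * pi \<partial>\<mu>)"
    using integrable_curl_pt[OF lift inv] by (intro integral_mono * integrable_norm) auto
  finally show ?thesis
    by (simp add: prob_space orbit_discrepancy_def)
qed

lemma discrepancy_mult_qd: "D x (b * qd m) \<le> real b * (10 * pi)"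
proof (induction b arbitrary: x)
  case (Suc b)
  have "D x (qd m + b * qd m) \<le> 10 * pi + real b * (10 * pi)"
    using discrepancy_add[of x "qd m" "b * qd m"] discrepancy_qd[of x m] Suc[of "(\<Phi> ^^ qd m) x"] by linarith
  then show ?case by (simp add: algebra_simps)
qed (simp add: orbit_discrepancy_def curl_pt_def)

lemma discrepancy_div_qd: "D x n \<le> real (n div qd m) * (10 * pi) + D ((\<Phi> ^^ (n div qd m * qd m)) x) (n mod qd m)"
  using discrepancy_add[of x "n div qd m * qd m" "n mod qd m"] discrepancy_mult_qd[of x "n div qd m" m]
  by simp

lemma real_div_le: "real (n div qd m) \<le> real n / cf_den \<rho> m"
  using of_nat_div_le_of_nat[of n "qd m", where ?'a = real] int_qd[of m] by (metis of_int_of_nat_eq)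

text \<open>Greedy expansion: at each level the digit is at most the ratio of consecutive
  denominators, each block costs \<open>10 * pi\<close>, and the remainder is passed to the next
  lower level from another starting point.\<close>

lemma discrepancy_Ostrowski:
  "n < qd m \<Longrightarrow> D x n \<le> 10 * pi * (\<Sum>i<m. cf_den \<rho> (Suc i) / cf_den \<rho> i)"
proof (induction m arbitrary: n x)
  case 0
  then show ?case by (simp add: orbit_discrepancy_def curl_pt_def)
next
  case (Suc m)
  have "real n \<le> cf_den \<rho> (Suc m)"
    using Suc.prems int_qd[of "Suc m"] by linarith
  then have "real (n div qd m) \<le> cf_den \<rho> (Suc m) / cf_den \<rho> m"
    using real_div_le[of n m] cf_den_pos[OF irr, of m]
    by (meson divide_right_mono of_int_nonneg order_trans zero_le_one)
  then have "real (n div qd m) * (10 * pi) \<le> cf_den \<rho> (Suc m) / cf_den \<rho> m * (10 * pi)"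
    by (rule mult_right_mono) simp
  moreover have "D ((\<Phi> ^^ (n div qd m * qd m)) x) (n mod qd m)
      \<le> 10 * pi * (\<Sum>i<m. cf_den \<rho> (Suc i) / cf_den \<rho> i)"
    using qd_pos by (intro Suc.IH) simp
  ultimately have "D x n \<le> cf_den \<rho> (Suc m) / cf_den \<rho> m * (10 * pi)
      + 10 * pi * (\<Sum>i<m. cf_den \<rho> (Suc i) / cf_den \<rho> i)"
    using discrepancy_div_qd[of x n m] by linarith
  then show ?case
    by (simp add: distrib_left mult.commute add.commute)
qed

text \<open>The top digit is bounded through \<open>n\<close> itself, since the ratio of
  denominators there may be far larger. The level depends on \<open>n\<close> only, which keeps the
  bound uniform in \<open>x\<close>.\<close>

lemma discrepancy_level:
  assumes "1 \<le> n"
  obtains m where "cf_den \<rho> m \<le> int n" "int n < cf_den \<rho> (Suc m)"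
    "\<And>x. D x n \<le> 10 * pi * (real n / cf_den \<rho> m + (\<Sum>i<m. cf_den \<rho> (Suc i) / cf_den \<rho> i))"
proof -
  have "\<exists>m. int n < cf_den \<rho> m"
  proof
    have "int n < 2 ^ n" by (rule of_nat_less_two_power)
    moreover have "2 ^ n \<le> cf_den \<rho> (2 * n)"
      using cf_den_ge_power[OF irr, of "2 * n"] by simp
    ultimately show "int n < cf_den \<rho> (2 * n)" by linarith
  qed
  \<comment> \<open>\<open>cf_den \<rho> 0 = 1\<close> excludes index 0, so the first denominator
    exceeding \<open>n\<close> has a predecessor.\<close>
  moreover have "\<not> int n < cf_den \<rho> 0" using assms by simp
  ultimately obtain m where m: "\<not> int n < cf_den \<rho> m" "int n < cf_den \<rho> (Suc m)"
    using exists_least_lemma[of "\<lambda>m. int n < cf_den \<rho> m"] by auto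
  have "D x n \<le> 10 * pi * (real n / cf_den \<rho> m + (\<Sum>i<m. cf_den \<rho> (Suc i) / cf_den \<rho> i))" for x
  proof -
    have "real (n div qd m) * (10 * pi) \<le> real n / cf_den \<rho> m * (10 * pi)"
      using real_div_le by (rule mult_right_mono) simp
    moreover have "D ((\<Phi> ^^ (n div qd m * qd m)) x) (n mod qd m)
        \<le> 10 * pi * (\<Sum>i<m. cf_den \<rho> (Suc i) / cf_den \<rho> i)"
      using qd_pos by (intro discrepancy_Ostrowski) simp
    ultimately have "D x n \<le> real n / cf_den \<rho> m * (10 * pi)
        + 10 * pi * (\<Sum>i<m. cf_den \<rho> (Suc i) / cf_den \<rho> i)"
      using discrepancy_div_qd[of x n m] by linarith
    then show ?thesis
      by (simp add: distrib_left mult.commute)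
  qed
  then show thesis using m that by (simp only: not_less)
qed

text \<open>One fixed large denominator suffices: full blocks cost \<open>10 * pi\<close> per
  \<open>qd ?m\<close> steps, at most half of \<open>c * n\<close>, and the remainder, shorter than
  one block, fits into the other half for large \<open>n\<close>.\<close>

lemma discrepancy_smallo_uniform:
  assumes c: "0 < c"
  shows "\<forall>\<^sub>F n in sequentially. \<forall>x. D x n \<le> c * real n"
proof -
  obtain k where k: "20 * pi / c < 2 ^ k"
    using real_arch_pow[of 2] by auto
  let ?m = "2 * k" let ?q = "real (qd ?m)"
  have "(2::int) ^ k \<le> int (qd ?m)"
    unfolding int_qd using cf_den_ge_power[OF irr, of ?m] by simp
  then have "2 ^ k \<le> ?q"
    by (metis of_int_le_iff of_int_numeral of_int_of_nat_eq of_int_power)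
  then have q: "20 * pi / c < ?q" using k by linarith
  have "\<forall>\<^sub>F n in sequentially. 4 * ?q / c \<le> real n"
    using eventually_ge_at_top[of "nat \<lceil>4 * ?q / c\<rceil>"] by eventually_elim linarith
  then show ?thesis
  proof (eventually_elim, intro allI)
    fix n x assume n: "4 * ?q / c \<le> real n"
    have "real (n div qd ?m) * (10 * pi) \<le> (real n / ?q) * (10 * pi)"
      using of_nat_div_le_of_nat by (rule mult_right_mono) simp
    also have "\<dots> \<le> c / 2 * real n"
    proof -
      have "10 * pi / ?q \<le> c / 2"
        using q c qd_pos[of ?m] by (simp add: field_simps)
      then have "10 * pi / ?q * real n \<le> c / 2 * real n"
        by (rule mult_right_mono) simp
      then show ?thesis by (simp add: mult_ac)
    qed
    finally have 1: "real (n div qd ?m) * (10 * pi) \<le> c / 2 * real n" .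
    have "n mod qd ?m \<le> qd ?m"
      using qd_pos[of ?m] by (intro less_imp_le mod_less_divisor)
    then have "real (n mod qd ?m) \<le> ?q"
      by (simp only: of_nat_le_iff)
    then have 2: "D y (n mod qd ?m) \<le> 2 * ?q" for y
      using discrepancy_le[of y "n mod qd ?m"] by linarith
    have "2 * ?q \<le> c / 2 * real n"
      using n c by (simp add: field_simps)
    then have "D x n \<le> c / 2 * real n + c / 2 * real n"
      using discrepancy_div_qd[of x n ?m] 1 2[of "(\<Phi> ^^ (n div qd ?m * qd ?m)) x"] by linarith
    also have "\<dots> = c * real n" by simp
    finally show "D x n \<le> c * real n" .
  qed
qed

text \<open>Common frame for the three growth rates: there are \<open>m + 1\<close> digits, with
  \<open>m\<close> logarithmic in \<open>n\<close>, each bounded by \<open>R m\<close>. The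
  \<open>min\<close> gives the ratio of denominators below level \<open>m\<close> and the top digit
  at level \<open>m\<close>.\<close>

lemma discrepancy_ratio:
  assumes n: "1 \<le> n"
    and R: "\<And>i m. i \<le> m \<Longrightarrow> cf_den \<rho> m \<le> int n \<Longrightarrow>
      min (real n) (cf_den \<rho> (Suc i)) / cf_den \<rho> i \<le> R m"
  obtains m where "real m \<le> 4 * ln (real n) + 1" "0 \<le> R m"
    "\<And>x. D x n \<le> 10 * pi * ((real m + 1) * R m)"
proof -
  obtain m where m: "cf_den \<rho> m \<le> int n" "int n < cf_den \<rho> (Suc m)"
    and D: "\<And>x. D x n \<le> 10 * pi * (real n / cf_den \<rho> m + (\<Sum>i<m. cf_den \<rho> (Suc i) / cf_den \<rho> i))"
    using discrepancy_level[OF n] by metis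
  have "real_of_int (int n) \<le> cf_den \<rho> (Suc m)"
    using m(2) by linarith
  then have "min (real n) (cf_den \<rho> (Suc m)) = real n" by simp
  then have 1: "real n / cf_den \<rho> m \<le> R m"
    using R[OF order_refl m(1)] by simp
  have 2: "cf_den \<rho> (Suc i) / cf_den \<rho> i \<le> R m" if "i < m" for i
  proof -
    have "cf_den \<rho> (Suc i) \<le> int n"
      using cf_den_mono[OF irr, of "Suc i" m] that m(1) by linarith
    then have "real_of_int (cf_den \<rho> (Suc i)) \<le> real_of_int (int n)"
      by (simp only: of_int_le_iff)
    then have "min (real n) (cf_den \<rho> (Suc i)) = cf_den \<rho> (Suc i)" by simp
    then show ?thesis
      using R[OF less_imp_le[OF that] m(1)] by simp
  qed
  have "(\<Sum>i<m. cf_den \<rho> (Suc i) / cf_den \<rho> i) \<le> (\<Sum>i<m. R m)"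
    using 2 by (intro sum_mono) simp
  then have "real n / cf_den \<rho> m + (\<Sum>i<m. cf_den \<rho> (Suc i) / cf_den \<rho> i) \<le> (real m + 1) * R m"
    using 1 by (simp add: algebra_simps)
  then have "10 * pi * (real n / cf_den \<rho> m + (\<Sum>i<m. cf_den \<rho> (Suc i) / cf_den \<rho> i)) \<le>
      10 * pi * ((real m + 1) * R m)"
    by (rule mult_left_mono) simp
  then have "D x n \<le> 10 * pi * ((real m + 1) * R m)" for x
    using D[of x] by linarith
  moreover have "0 \<le> R m"
    using 1 cf_den_pos[OF irr, of m] by (intro order_trans[OF _ 1]) simp
  ultimately show thesis
    using that cf_den_index_le_ln[OF irr m(1)] by blast
qed

section \<open>Growth rates from arithmetic conditions\<close>

lemma ln_ge_1: "3 \<le> n \<Longrightarrow> 1 \<le> ln (real n)"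
  using exp_le by (subst ln_ge_iff) auto

text \<open>The Diophantine lower bound against the upper bound \<open>cf_approx\<close> gives
  \<open>C * q' \<le> q powr r\<close> for consecutive denominators \<open>q\<close>,
  \<open>q'\<close>. Digits are thus at most a constant times \<open>n powr (1 - 1 / r)\<close>, and
  their number supplies the logarithm.\<close>

lemma discrepancy_diophantine:
  assumes r: "1 < r" and dio: "diophantine_type \<rho> r"
  shows "(\<lambda>n. D x n) \<in> O(\<lambda>n. real n powr (1 - 1 / r) * ln (real n))"
proof -
  obtain C where C: "0 < C"
    and dio_C: "\<And>p q :: int. 0 < q \<Longrightarrow> C / real_of_int q powr (1 + r) \<le> \<bar>\<rho> - real_of_int p / real_of_int q\<bar>"
    using dio unfolding diophantine_type_def by blast
  define K where "K = C powr (- 1 / r)"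
  \<comment> \<open>Stated for any \<open>t\<close> up to the next denominator, so that it applies
    to that denominator capped at \<open>n\<close>.\<close>
  have ratio: "t / cf_den \<rho> i \<le> K * t powr (1 - 1 / r)" if t: "0 < t" "t \<le> cf_den \<rho> (Suc i)" for t :: real and i
  proof -
    let ?q = "real_of_int (cf_den \<rho> i)" and ?q' = "real_of_int (cf_den \<rho> (Suc i))"
      and ?p = "real_of_int (cf_num \<rho> i)"
    have q: "1 \<le> ?q" "1 \<le> ?q'"
      using cf_den_pos[OF irr] by (simp_all del: cf_den.simps)
    have "C / ?q powr (1 + r) \<le> \<bar>\<rho> - ?p / ?q\<bar>"
      using q by (intro dio_C) simp
    also have "\<bar>\<rho> - ?p / ?q\<bar> = \<bar>(?q * \<rho> - ?p) / ?q\<bar>"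
      using q by (simp add: field_simps)
    also have "\<dots> = \<bar>?q * \<rho> - ?p\<bar> / ?q"
      using q by (simp add: abs_divide)
    also have "\<dots> \<le> (1 / ?q') / ?q"
      using cf_approx[OF irr, of i] q by (intro divide_right_mono) (simp_all add: field_simps)
    finally have "C * ?q' * ?q \<le> ?q powr (1 + r)"
      using q by (simp add: field_simps)
    then have "C * ?q' \<le> ?q powr r"
      using q by (simp add: powr_add mult.commute)
    then have "C * t \<le> ?q powr r"
      using t C mult_left_mono[of t ?q' C] by linarith
    then have "(C * t) powr (1 / r) \<le> (?q powr r) powr (1 / r)"
      using r C t by (intro powr_mono2) auto
    then have "(C * t) powr (1 / r) \<le> ?q"
      using q r by (simp add: powr_powr)
    then have "t / ?q \<le> t / (C * t) powr (1 / r)"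
      using t C q by (intro divide_left_mono) auto
    also have "\<dots> = K * t powr (1 - 1 / r)"
      using t C by (simp add: K_def powr_mult powr_diff powr_minus field_simps)
    finally show ?thesis .
  qed
  show ?thesis
  proof (rule bigoI)
    show "\<forall>\<^sub>F n in sequentially. norm (D x n) \<le> (10 * pi * 6 * K) * norm (real n powr (1 - 1 / r) * ln (real n))"
      using eventually_ge_at_top[of 3]
    proof eventually_elim
      fix n :: nat assume n: "3 \<le> n"
      then have n1: "1 \<le> n" by simp
      obtain m where m: "real m \<le> 4 * ln (real n) + 1" "0 \<le> K * real n powr (1 - 1 / r)"
        and D: "\<And>x. D x n \<le> 10 * pi * ((real m + 1) * (K * real n powr (1 - 1 / r)))"
      proof (rule discrepancy_ratio[OF n1, where R = "\<lambda>m. K * real n powr (1 - 1 / r)"])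
        fix i m
        let ?t = "min (real n) (cf_den \<rho> (Suc i))"
        have "1 \<le> real_of_int (cf_den \<rho> (Suc i))"
          using cf_den_pos[OF irr] by (simp del: cf_den.simps)
        then have t: "0 < ?t" "?t \<le> cf_den \<rho> (Suc i)" "?t \<le> real n"
          using n by auto
        have "?t / cf_den \<rho> i \<le> K * ?t powr (1 - 1 / r)"
          using t by (intro ratio)
        also have "\<dots> \<le> K * real n powr (1 - 1 / r)"
          using t r by (intro mult_left_mono powr_mono2) (auto simp: K_def)
        finally show "?t / cf_den \<rho> i \<le> K * real n powr (1 - 1 / r)" .
      qed auto
      \<comment> \<open>For \<open>n \<ge> 3\<close> the logarithm is at least 1, so 4 times it plus
        2 is at most 6 times it.\<close>
      have "real m + 1 \<le> 6 * ln (real n)"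
        using m(1) ln_ge_1[OF n] by linarith
      then have "(real m + 1) * (K * real n powr (1 - 1 / r)) \<le> 6 * ln (real n) * (K * real n powr (1 - 1 / r))"
        using m(2) by (rule mult_right_mono)
      then have "10 * pi * ((real m + 1) * (K * real n powr (1 - 1 / r))) \<le>
          10 * pi * (6 * ln (real n) * (K * real n powr (1 - 1 / r)))"
        by (rule mult_left_mono) simp
      then have "D x n \<le> (10 * pi * 6 * K) * (real n powr (1 - 1 / r) * ln (real n))"
        using D[of x] by (simp add: mult_ac)
      moreover have "0 \<le> D x n" by (simp add: orbit_discrepancy_def)
      moreover have "0 \<le> ln (real n)" using ln_ge_1[OF n] by simp
      ultimately show "norm (D x n) \<le> (10 * pi * 6 * K) * norm (real n powr (1 - 1 / r) * ln (real n))"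
        by (simp add: abs_mult)
    qed
  qed
qed

text \<open>All digits share one constant bound, so the rate is their logarithmic number.\<close>

lemma discrepancy_bounded_type:
  assumes "bounded_type \<rho>"
  shows "(\<lambda>n. D x n) \<in> O(\<lambda>n. ln (real n))"
proof -
  obtain K where K: "\<And>i. cf_den \<rho> (Suc i) / cf_den \<rho> i \<le> K"
    using assms unfolding bounded_type_def bdd_above_def by auto
  show ?thesis
  proof (rule bigoI)
    show "\<forall>\<^sub>F n in sequentially. norm (D x n) \<le> (10 * pi * 6 * K) * norm (ln (real n))"
      using eventually_ge_at_top[of 3]
    proof eventually_elim
      fix n :: nat assume n: "3 \<le> n"
      then have n1: "1 \<le> n" by simp
      obtain m where m: "real m \<le> 4 * ln (real n) + 1" "0 \<le> K"
        and D: "\<And>x. D x n \<le> 10 * pi * ((real m + 1) * K)"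
      proof (rule discrepancy_ratio[OF n1, where R = "\<lambda>m. K"])
        fix i
        have "min (real n) (cf_den \<rho> (Suc i)) / cf_den \<rho> i \<le> cf_den \<rho> (Suc i) / cf_den \<rho> i"
          using cf_den_pos[OF irr, of i] by (intro divide_right_mono) auto
        then show "min (real n) (cf_den \<rho> (Suc i)) / cf_den \<rho> i \<le> K"
          using K by (rule order_trans)
      qed auto
      have "real m + 1 \<le> 6 * ln (real n)"
        using m(1) ln_ge_1[OF n] by linarith
      then have "(real m + 1) * K \<le> 6 * ln (real n) * K"
        using m(2) by (rule mult_right_mono)
      then have "10 * pi * ((real m + 1) * K) \<le> 10 * pi * (6 * ln (real n) * K)"
        by (rule mult_left_mono) simp
      then have "D x n \<le> (10 * pi * 6 * K) * ln (real n)"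
        using D[of x] by (simp add: mult_ac)
      moreover have "0 \<le> D x n" by (simp add: orbit_discrepancy_def)
      ultimately show "norm (D x n) \<le> (10 * pi * 6 * K) * norm (ln (real n))"
        using ln_ge_1[OF n] by simp
    qed
  qed
qed

text \<open>Ratios of denominators exceed partial quotients by at most 1, so digits are of order
  \<open>(m + 2) powr (1 + \<epsilon>)\<close>; the number of digits adds 1 to the exponent.\<close>

lemma discrepancy_slow_quotients:
  assumes \<epsilon>: "0 < \<epsilon>" and slow: "slow_quotients \<rho> \<epsilon>"
  shows "(\<lambda>n. D x n) \<in> O(\<lambda>n. ln (real n) powr (2 + \<epsilon>))"
proof -
  obtain N where N: "\<And>m. N \<le> m \<Longrightarrow> real_of_int (cf_quot \<rho> m) < real (m + 1) powr (1 + \<epsilon>)"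
    using slow unfolding slow_quotients_def eventually_sequentially by blast
  \<comment> \<open>The sum covers the quotients before \<open>N\<close>, in absolute value since
    the one at index 0 may be negative; the summand 2 absorbs the \<open>+ 1\<close> before and
    beyond \<open>N\<close>.\<close>
  define B where "B = (\<Sum>m<N. \<bar>real_of_int (cf_quot \<rho> m)\<bar>) + 2"
  have B: "2 \<le> B" by (simp add: B_def sum_nonneg)
  have quot: "cf_quot \<rho> m + 1 \<le> B * real (m + 1) powr (1 + \<epsilon>)" for m
  proof -
    have 1: "1 \<le> real (m + 1) powr (1 + \<epsilon>)"
      using \<epsilon> by (intro ge_one_powr_ge_zero) auto
    show ?thesis
    proof (cases "m < N")
      case True
      then have "\<bar>real_of_int (cf_quot \<rho> m)\<bar> \<le> (\<Sum>m<N. \<bar>real_of_int (cf_quot \<rho> m)\<bar>)"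
        by (intro member_le_sum) auto
      then have "cf_quot \<rho> m + 1 \<le> B" by (simp add: B_def)
      also have "B \<le> B * real (m + 1) powr (1 + \<epsilon>)"
        using mult_left_mono[OF 1, of B] B by simp
      finally show ?thesis .
    next
      case False
      then have "cf_quot \<rho> m + 1 \<le> 2 * real (m + 1) powr (1 + \<epsilon>)"
        using N[of m] 1 by linarith
      also have "\<dots> \<le> B * real (m + 1) powr (1 + \<epsilon>)"
        using B by (intro mult_right_mono) auto
      finally show ?thesis .
    qed
  qed
  \<comment> \<open>The 7 arises from \<open>m + 2 \<le> 4 * ln (real n) + 3\<close> and
    \<open>ln (real n) \<ge> 1\<close>.\<close>
  define c where "c = 10 * pi * (B * 7 powr (2 + \<epsilon>))"
  show ?thesis
  proof (rule bigoI)
    show "\<forall>\<^sub>F n in sequentially. norm (D x n) \<le> c * norm (ln (real n) powr (2 + \<epsilon>))"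
      using eventually_ge_at_top[of 3]
    proof eventually_elim
      fix n :: nat assume n: "3 \<le> n"
      then have n1: "1 \<le> n" by simp
      obtain m where m: "real m \<le> 4 * ln (real n) + 1"
        and D: "\<And>x. D x n \<le> 10 * pi * ((real m + 1) * (B * real (m + 2) powr (1 + \<epsilon>)))"
      proof (rule discrepancy_ratio[OF n1, where R = "\<lambda>m. B * real (m + 2) powr (1 + \<epsilon>)"])
        fix i m :: nat assume im: "i \<le> m"
        have q: "0 < real_of_int (cf_den \<rho> i)"
          using cf_den_pos[OF irr, of i] by simp
        have "real_of_int (cf_den \<rho> (Suc i)) \<le> of_int ((cf_quot \<rho> (Suc i) + 1) * cf_den \<rho> i)"
          using cf_den_Suc_le[OF irr, of i] by (simp only: of_int_le_iff)
        then have "cf_den \<rho> (Suc i) / cf_den \<rho> i \<le> cf_quot \<rho> (Suc i) + 1"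
          using q by (simp add: divide_le_eq del: cf_den.simps)
        moreover have "min (real n) (cf_den \<rho> (Suc i)) / cf_den \<rho> i \<le> cf_den \<rho> (Suc i) / cf_den \<rho> i"
          using q by (intro divide_right_mono) auto
        moreover have "cf_quot \<rho> (Suc i) + 1 \<le> B * real (i + 2) powr (1 + \<epsilon>)"
          using quot[of "Suc i"] by simp
        moreover have "B * real (i + 2) powr (1 + \<epsilon>) \<le> B * real (m + 2) powr (1 + \<epsilon>)"
          using B \<epsilon> im by (intro mult_left_mono powr_mono2) auto
        ultimately show "min (real n) (cf_den \<rho> (Suc i)) / cf_den \<rho> i \<le> B * real (m + 2) powr (1 + \<epsilon>)"
          by linarith
      qed auto
      have "(real m + 1) * (B * real (m + 2) powr (1 + \<epsilon>)) \<le> real (m + 2) * (B * real (m + 2) powr (1 + \<epsilon>))"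
        using B by (intro mult_right_mono) auto
      also have "\<dots> = B * real (m + 2) powr (2 + \<epsilon>)"
        using powr_add[of "real (m + 2)" 1 "1 + \<epsilon>"] by (simp add: mult_ac add_ac)
      also have "\<dots> \<le> B * (7 * ln (real n)) powr (2 + \<epsilon>)"
        using m ln_ge_1[OF n] B \<epsilon> by (intro mult_left_mono powr_mono2) auto
      also have "\<dots> = B * 7 powr (2 + \<epsilon>) * ln (real n) powr (2 + \<epsilon>)"
        using ln_ge_1[OF n] by (simp add: powr_mult)
      finally have "10 * pi * ((real m + 1) * (B * real (m + 2) powr (1 + \<epsilon>))) \<le>
          10 * pi * (B * 7 powr (2 + \<epsilon>) * ln (real n) powr (2 + \<epsilon>))"
        by (rule mult_left_mono) simp
      then have "D x n \<le> c * ln (real n) powr (2 + \<epsilon>)"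
        using D[of x] by (simp add: c_def mult_ac)
      moreover have "0 \<le> D x n" by (simp add: orbit_discrepancy_def)
      ultimately show "norm (D x n) \<le> c * norm (ln (real n) powr (2 + \<epsilon>))"
        by simp
    qed
  qed
qed

end

section \<open>Superficiality of curlicues\<close>

lemma curl_pt_Suc: "curl_pt \<Phi> x (Suc n) = curl_pt \<Phi> x n + cis (2 * pi * (\<Phi> ^^ n) x)"
  by (simp add: curl_pt_def)

lemma curl_path_segment:
  assumes "0 \<le> s" "s < 1"
  shows "curl_path \<Phi> x (real k + s) = curl_pt \<Phi> x k + of_real s * cis (2 * pi * (\<Phi> ^^ k) x)"
proof -
  have floor: "\<lfloor>real k + s\<rfloor> = int k"
    using assms by (intro floor_unique) auto
  then have "nat \<lfloor>real k + s\<rfloor> = k" "frac (real k + s) = s"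
    by (simp_all add: frac_def)
  then show ?thesis
    unfolding curl_path_def curl_pt_Suc by simp
qed

lemma curl_path_of_nat: "curl_path \<Phi> x (real n) = curl_pt \<Phi> x n"
  using curl_path_segment[of 0 \<Phi> x n] by simp

lemma norm_curl_path_le: "norm (curl_path \<Phi> x t) \<le> norm (curl_pt \<Phi> x (nat \<lfloor>t\<rfloor>)) + 1"
proof -
  have "norm (curl_path \<Phi> x t) \<le> norm (curl_pt \<Phi> x (nat \<lfloor>t\<rfloor>)) + \<bar>frac t\<bar> * 1"
    unfolding curl_path_def curl_pt_Suc
    by (rule order_trans[OF norm_triangle_ineq]) (simp add: norm_mult)
  also have "\<bar>frac t\<bar> * 1 \<le> 1"
    using frac_lt_1[of t] by simp
  finally show ?thesis by simp
qed

lemma norm_curl_path_le_time: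
  assumes "0 \<le> t"
  shows "norm (curl_path \<Phi> x t) \<le> t + 1"
proof -
  have "norm (curl_pt \<Phi> x (nat \<lfloor>t\<rfloor>)) \<le> real (nat \<lfloor>t\<rfloor>)"
    by (rule norm_curl_pt_le)
  also have "\<dots> \<le> t" using assms by linarith
  finally show ?thesis
    using norm_curl_path_le[of \<Phi> x t] by linarith
qed

lemma bounded_curl_path_initial: "bounded (curl_path \<Phi> x ` {0..t})"
proof (rule boundedI)
  fix y assume "y \<in> curl_path \<Phi> x ` {0..t}"
  then obtain s where "0 \<le> s" "s \<le> t" "y = curl_path \<Phi> x s" by auto
  then show "norm y \<le> t + 1"
    using norm_curl_path_le_time[of s \<Phi> x] by simp
qed

section \<open>Diameter against arc length\<close>

lemma norm_curl_pt_le_diameter: "norm (curl_pt \<Phi> x n) \<le> diameter (curl_path \<Phi> x ` {0..real n})"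
proof -
  have "dist (curl_path \<Phi> x (real n)) (curl_path \<Phi> x (real 0)) \<le> diameter (curl_path \<Phi> x ` {0..real n})"
    by (intro diameter_bounded_bound bounded_curl_path_initial imageI) auto
  then show ?thesis
    unfolding curl_path_of_nat by (simp add: curl_pt_def)
qed

text \<open>The curve starts at 0, so for large \<open>n\<close> its diameter up to time
  \<open>n\<close> is at least \<open>c * n\<close>: it is unbounded, and length over diameter stays
  at or below \<open>1 / c\<close> along the integers.\<close>

lemma not_superficial_if_linear_growth:
  assumes c: "0 < c" and growth: "\<forall>\<^sub>F n in sequentially. c * real n \<le> norm (curl_pt \<Phi> x n)"
  shows "\<not> superficial (curl_path \<Phi> x)"
proof -
  have "\<not> bounded (curl_path \<Phi> x ` {0..})"
  proof
    assume "bounded (curl_path \<Phi> x ` {0..})"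
    then obtain B where "\<And>t. 0 \<le> t \<Longrightarrow> norm (curl_path \<Phi> x t) \<le> B"
      by (auto simp: bounded_iff)
    then have B: "norm (curl_pt \<Phi> x n) \<le> B" for n
      by (metis curl_path_of_nat of_nat_0_le_iff)
    obtain N where N: "\<And>n. N \<le> n \<Longrightarrow> c * real n \<le> norm (curl_pt \<Phi> x n)"
      using growth unfolding eventually_sequentially by blast
    obtain k where "B / c < real k" using reals_Archimedean2 by blast
    then have "B / c < real (max N k)" by simp
    then have "B < c * real (max N k)" using c by (simp add: field_simps del: of_nat_max)
    then show False using N[of "max N k"] B[of "max N k"] by simp
  qed
  moreover have "\<not> filterlim (\<lambda>t. t / diameter (curl_path \<Phi> x ` {0..t})) at_top at_top"
  proof
    assume "filterlim (\<lambda>t. t / diameter (curl_path \<Phi> x ` {0..t})) at_top at_top"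
    then have "filterlim (\<lambda>n. real n / diameter (curl_path \<Phi> x ` {0..real n})) at_top sequentially"
      by (rule filterlim_compose) (rule filterlim_real_sequentially)
    then have "\<forall>\<^sub>F n in sequentially. 1 / c < real n / diameter (curl_path \<Phi> x ` {0..real n})"
      by (simp add: filterlim_at_top_dense)
    then have "\<forall>\<^sub>F n in sequentially. False"
      using growth eventually_gt_at_top[of 0]
    proof eventually_elim
      fix n :: nat
      let ?d = "diameter (curl_path \<Phi> x ` {0..real n})"
      assume *: "1 / c < real n / ?d" "c * real n \<le> norm (curl_pt \<Phi> x n)" "0 < n"
      then have "c * real n \<le> ?d"
        using norm_curl_pt_le_diameter[of \<Phi> x n] by linarith
      moreover have "0 < c * real n" using * c by simp
      ultimately have "real n / ?d \<le> 1 / c"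
        using c by (simp add: field_simps)
      then show False using * by simp
    qed
    then show False by simp
  qed
  ultimately show ?thesis by (simp add: superficial_def)
qed

text \<open>Up to time \<open>t\<close> the curve stays within \<open>c * t + 1\<close> of 0 from
  index \<open>N\<close> on and within \<open>N + 1\<close> before. For large \<open>t\<close> the
  linear term with its arbitrarily small \<open>c\<close> controls the diameter.\<close>

lemma diameter_curl_path_sublinear:
  assumes sub: "\<And>c. 0 < c \<Longrightarrow> \<forall>\<^sub>F n in sequentially. norm (curl_pt \<Phi> x n) \<le> c * real n"
  shows "filterlim (\<lambda>t. t / diameter (curl_path \<Phi> x ` {0..t})) at_top at_top"
  unfolding filterlim_at_top_gt[where c = 0]
proof (intro allI impI)
  fix Z :: real assume Z: "0 < Z"
  \<comment> \<open>The diameter is at most \<open>2 * b\<close>, and \<open>b\<close> consists of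
    two parts of size at most \<open>t / (4 * Z)\<close>.\<close>
  define c where "c = 1 / (4 * Z)"
  have c: "0 < c" using Z by (simp add: c_def)
  obtain N where N: "\<And>n. N \<le> n \<Longrightarrow> norm (curl_pt \<Phi> x n) \<le> c * real n"
    using sub[OF c] unfolding eventually_sequentially by blast
  show "\<forall>\<^sub>F t in at_top. Z \<le> t / diameter (curl_path \<Phi> x ` {0..t})"
    using eventually_ge_at_top[of 1] eventually_ge_at_top[of "4 * Z * (real N + 1)"]
  proof eventually_elim
    fix t :: real assume t: "1 \<le> t" "4 * Z * (real N + 1) \<le> t"
    let ?d = "diameter (curl_path \<Phi> x ` {0..t})"
    define b where "b = c * t + (real N + 1)"
    have b: "b \<le> 2 * (t / (4 * Z))"
    proof -
      have "real N + 1 \<le> t / (4 * Z)"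
        using t Z by (simp add: pos_le_divide_eq mult.commute)
      moreover have "c * t = t / (4 * Z)"
        by (simp add: c_def)
      ultimately show ?thesis unfolding b_def by linarith
    qed
    have ct: "0 \<le> c * t" using c t by simp
    have bound: "norm (curl_path \<Phi> x s) \<le> b" if "0 \<le> s" "s \<le> t" for s
    proof (cases "N \<le> nat \<lfloor>s\<rfloor>")
      case True
      have "c * real (nat \<lfloor>s\<rfloor>) \<le> c * t"
        using c that by (intro mult_left_mono) linarith+
      then show ?thesis
        using N[OF True] norm_curl_path_le[of \<Phi> x s] unfolding b_def by linarith
    next
      case False
      then show ?thesis
        using norm_curl_path_le_time[of s \<Phi> x] that ct unfolding b_def by linarith
    qed
    have "?d \<le> 2 * b"
    proof (rule diameter_le)
      fix y z assume "y \<in> curl_path \<Phi> x ` {0..t}" "z \<in> curl_path \<Phi> x ` {0..t}"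
      then have "norm y \<le> b" "norm z \<le> b"
        using bound by auto
      then show "norm (y - z) \<le> 2 * b"
        using norm_triangle_ineq4[of y z] by linarith
    qed (use t in auto)
    also have "\<dots> \<le> 4 * (t / (4 * Z))"
      using b by linarith
    finally have "?d \<le> t / Z" by simp
    \<comment> \<open>Division by 0 would give 0; the first unit segment keeps the diameter
      positive.\<close>
    moreover have "0 < ?d"
    proof -
      have "diameter (curl_path \<Phi> x ` {0..real 1}) \<le> ?d"
        by (rule diameter_subset[OF _ bounded_curl_path_initial]) (use t in auto)
      then show ?thesis
        using norm_curl_pt_le_diameter[of \<Phi> x 1] by (simp add: curl_pt_def)
    qed
    ultimately show "Z \<le> t / ?d"
      using Z by (simp add: field_simps)
  qed
qed

section \<open>Area of neighbourhoods of bounded curves\<close>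

lemma finite_card_diff_bounded:
  fixes S :: "nat set"
  assumes "\<And>i j. i \<in> S \<Longrightarrow> j \<in> S \<Longrightarrow> i \<le> j + r"
  shows "finite S" "card S \<le> Suc r"
proof -
  have "finite S \<and> card S \<le> Suc r"
  proof (cases "S = {}")
    case False
    define a where "a = (LEAST i. i \<in> S)"
    have "a \<in> S" using False unfolding a_def by (auto intro: LeastI)
    then have sub: "S \<subseteq> {a..a + r}"
      using assms by (auto simp: a_def intro: Least_le)
    then show ?thesis
      using finite_subset[OF sub] card_mono[OF _ sub] by auto
  qed simp
  then show "finite S" "card S \<le> Suc r" by auto
qed

text \<open>Only boundedly many of the points spaced \<open>2\<epsilon>\<close> apart on a segment lie within \<open>2\<epsilon>\<close> of the line
  through another, nonparallel segment. Balls of radius \<open>\<epsilon>\<close> about the others are disjoint from each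
  other and fill, on \<open>card K\<close> segments, an area of about \<open>(card K / 2\<epsilon>) \<pi>\<epsilon>\<^sup>2\<close>.\<close>

lemma area_neighbourhood_segments:
  fixes z u :: "nat \<Rightarrow> complex" and T :: "complex set"
  assumes K: "finite K" and u: "\<And>k. norm (u k) = 1"
    and transversal: "\<And>k l. k \<in> K \<Longrightarrow> l \<in> K \<Longrightarrow> k \<noteq> l \<Longrightarrow> \<delta> \<le> \<bar>Im (u k * cnj (u l))\<bar>"
    and \<delta>: "0 < \<delta>" and \<epsilon>: "0 < \<epsilon>" and T: "T \<in> fmeasurable lborel"
    and balls: "\<And>k s. k \<in> K \<Longrightarrow> 0 \<le> s \<Longrightarrow> s < 1 \<Longrightarrow> ball (z k + of_real s * u k) \<epsilon> \<subseteq> T"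
  shows "real (card K) * (1 / (2 * \<epsilon>) - 1 - real (card K) * (2 / \<delta> + 2)) * (pi * \<epsilon>\<^sup>2) \<le> measure lborel T"
proof -
  define J where "J = nat \<lceil>1 / (2 * \<epsilon>)\<rceil> - 1"
  define r where "r = nat \<lceil>2 / \<delta>\<rceil>"
  define P where "P k j = z k + of_real (2 * \<epsilon> * real j) * u k" for k j
  \<comment> \<open>\<open>Im ((w - z l) * cnj (u l))\<close> is the signed distance of
    \<open>w\<close> from the line through \<open>z l\<close> in direction
    \<open>u l\<close>.\<close>
  define bad where "bad k l = {j. \<bar>Im ((P k j - z l) * cnj (u l))\<bar> < 2 * \<epsilon>}" for k l
  define G where "G k = {..<J} - (\<Union>l\<in>K - {k}. bad k l)" for k
  have J: "real j * (2 * \<epsilon>) < 1" if "j < J" for j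
  proof -
    have "real j < 1 / (2 * \<epsilon>)" using that unfolding J_def by linarith
    then show ?thesis using \<epsilon> by (simp add: field_simps)
  qed
  have J_ge: "1 / (2 * \<epsilon>) - 1 \<le> real J"
    unfolding J_def by linarith
  have r: "real r \<le> 2 / \<delta> + 1"
    unfolding r_def using \<delta> by simp
  have bad: "finite (bad k l)" "card (bad k l) \<le> Suc r" if kl: "k \<in> K" "l \<in> K" "k \<noteq> l" for k l
  proof -
    let ?a = "Im ((z k - z l) * cnj (u l))" and ?s = "Im (u k * cnj (u l))"
    have Im: "Im ((P k j - z l) * cnj (u l)) = ?a + 2 * \<epsilon> * real j * ?s" for j
      by (simp add: P_def algebra_simps)
    \<comment> \<open>From \<open>j\<close> to \<open>i\<close> the signed distance changes by at
      least \<open>2 * \<epsilon> * \<delta> * (i - j)\<close>, which exceeds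
      \<open>4 * \<epsilon>\<close> once \<open>i - j > 2 / \<delta>\<close>.\<close>
    have "i \<le> j + r" if "i \<in> bad k l" "j \<in> bad k l" for i j
    proof (rule ccontr)
      assume "\<not> i \<le> j + r"
      then have "real r < real i - real j" by linarith
      moreover have "2 / \<delta> \<le> real r" unfolding r_def by linarith
      ultimately have "2 / \<delta> < real i - real j" "0 < real i - real j"
        by linarith+
      then have "2 < \<delta> * (real i - real j)" "0 < real i - real j"
        using \<delta> by (simp_all add: divide_less_eq mult.commute)
      then have "2 < \<bar>?s\<bar> * (real i - real j)"
        using mult_right_mono[OF transversal[OF kl], of "real i - real j"] by linarith
      then have "2 * \<epsilon> * 2 < 2 * \<epsilon> * (\<bar>?s\<bar> * (real i - real j))"
        using \<epsilon> by (intro mult_strict_left_mono) auto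
      also have "\<dots> = \<bar>(?a + 2 * \<epsilon> * real i * ?s) - (?a + 2 * \<epsilon> * real j * ?s)\<bar>"
      proof -
        have "(?a + 2 * \<epsilon> * real i * ?s) - (?a + 2 * \<epsilon> * real j * ?s) = 2 * \<epsilon> * (?s * (real i - real j))"
          by (simp only: algebra_simps)
        then show ?thesis
          using \<epsilon> \<open>0 < real i - real j\<close> by (simp add: abs_mult)
      qed
      also have "\<dots> < 2 * \<epsilon> + 2 * \<epsilon>"
        using that unfolding bad_def Im by simp
      finally show False by simp
    qed
    then show "finite (bad k l)" "card (bad k l) \<le> Suc r"
      using finite_card_diff_bounded[of "bad k l" r] by blast+
  qed
  have card_G: "1 / (2 * \<epsilon>) - 1 - real (card K) * (2 / \<delta> + 2) \<le> real (card (G k))" if k: "k \<in> K" for k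
  proof -
    have "card (\<Union>l\<in>K - {k}. bad k l) \<le> (\<Sum>l\<in>K - {k}. card (bad k l))"
      using K by (intro card_UN_le) auto
    also have "\<dots> \<le> (\<Sum>l\<in>K - {k}. Suc r)"
      using bad(2)[OF k] by (intro sum_mono) auto
    also have "\<dots> \<le> (\<Sum>l\<in>K. Suc r)"
      using K by (intro sum_mono2) auto
    finally have "card (\<Union>l\<in>K - {k}. bad k l) \<le> card K * Suc r" by simp
    moreover have "finite (\<Union>l\<in>K - {k}. bad k l)"
      using K bad(1)[OF k] by auto
    then have "card {..<J} - card (\<Union>l\<in>K - {k}. bad k l) \<le> card (G k)"
      unfolding G_def by (rule diff_card_le_card_Diff)
    ultimately have "J \<le> card (G k) + card K * Suc r" by simp
    then have "real J \<le> real (card (G k) + card K * Suc r)"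
      by (simp only: of_nat_le_iff)
    then have "real J \<le> real (card (G k)) + real (card K) * (real r + 1)"
      by (simp add: algebra_simps)
    moreover have "real (card K) * (real r + 1) \<le> real (card K) * (2 / \<delta> + 2)"
      using r by (intro mult_left_mono) auto
    ultimately show ?thesis using J_ge by linarith
  qed
  let ?I = "Sigma K G" and ?B = "\<lambda>(k, j). ball (P k j) \<epsilon>"
  have finI: "finite ?I"
    using K by (intro finite_SigmaI) (auto simp: G_def)
  \<comment> \<open>On one segment the spacing separates the points; otherwise \<open>P l i\<close>
    lies on a line from which \<open>P k j\<close> keeps distance
    \<open>2 * \<epsilon>\<close>.\<close>
  have sep: "2 * \<epsilon> \<le> dist (P k j) (P l i)" if "(k, j) \<in> ?I" "(l, i) \<in> ?I" "(k, j) \<noteq> (l, i)" for k j l i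
  proof (cases "k = l")
    case True
    then have "1 \<le> \<bar>real j - real i\<bar>" using that by auto
    then have "2 * \<epsilon> * 1 \<le> 2 * \<epsilon> * \<bar>real j - real i\<bar>"
      using \<epsilon> by (intro mult_left_mono) auto
    also have "\<dots> = norm (of_real (2 * \<epsilon> * (real j - real i)) * u k)"
      using \<epsilon> u by (simp add: norm_mult abs_mult del: of_real_mult of_real_diff)
    also have "of_real (2 * \<epsilon> * (real j - real i)) * u k = P k j - P l i"
      using True by (simp add: P_def algebra_simps)
    finally show ?thesis by (simp add: dist_norm)
  next
    case False
    have ul: "u l * cnj (u l) = 1"
      using complex_norm_square[of "u l"] u[of l] by simp
    have "(P k j - P l i) * cnj (u l) = (P k j - z l) * cnj (u l) - of_real (2 * \<epsilon> * real i) * (u l * cnj (u l))"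
      by (simp add: P_def[of l] algebra_simps)
    then have "Im ((P k j - P l i) * cnj (u l)) = Im ((P k j - z l) * cnj (u l))"
      unfolding ul by simp
    moreover have "j \<notin> bad k l"
      using that False unfolding G_def by blast
    then have "2 * \<epsilon> \<le> \<bar>Im ((P k j - z l) * cnj (u l))\<bar>"
      by (simp only: bad_def mem_Collect_eq not_less)
    ultimately have "2 * \<epsilon> \<le> norm ((P k j - P l i) * cnj (u l))"
      using abs_Im_le_cmod[of "(P k j - P l i) * cnj (u l)"] by linarith
    then show ?thesis
      using u by (simp add: norm_mult dist_norm)
  qed
  have meas_ball: "ball c \<epsilon> \<in> fmeasurable lborel" for c :: complex
    by (intro fmeasurableI emeasure_bounded_finite) auto
  have "(\<Sum>p\<in>?I. measure lborel (?B p)) = measure lborel (\<Union>p\<in>?I. ?B p)"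
  proof (rule measure_UNION'[symmetric, OF finI])
    show "pairwise (\<lambda>p q. disjnt (?B p) (?B q)) ?I"
    proof (rule pairwiseI)
      fix p q assume *: "p \<in> ?I" "q \<in> ?I" "p \<noteq> q"
      obtain k j l i where pq: "p = (k, j)" "q = (l, i)" by (cases p, cases q)
      have "2 * \<epsilon> \<le> dist (P k j) (P l i)" using * sep unfolding pq by blast
      then have "ball (P k j) \<epsilon> \<inter> ball (P l i) \<epsilon> = {}"
        by (intro disjoint_ballI) simp
      then show "disjnt (?B p) (?B q)"
        by (simp add: pq disjnt_def)
    qed
  qed (use meas_ball in auto)
  also have "\<dots> \<le> measure lborel T"
  proof (rule measure_mono_fmeasurable[OF _ _ T])
    show "(\<Union>p\<in>?I. ?B p) \<subseteq> T"
    proof (rule UN_least)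
      fix p assume "p \<in> ?I"
      then obtain k j where p: "p = (k, j)" "k \<in> K" "j < J" by (auto simp: G_def)
      then show "?B p \<subseteq> T"
        using balls[of k "2 * \<epsilon> * real j"] J[of j] \<epsilon> by (simp add: P_def mult_ac)
    qed
  qed (use finI meas_ball in \<open>auto intro!: sets.finite_UN\<close>)
  also have "(\<Sum>p\<in>?I. measure lborel (?B p)) = (\<Sum>p\<in>?I. pi * \<epsilon>\<^sup>2)"
  proof (rule sum.cong)
    fix p assume "p \<in> ?I"
    obtain k j where "p = (k, j)" by (cases p)
    then show "measure lborel (?B p) = pi * \<epsilon>\<^sup>2"
      using content_ball[of \<epsilon> "P k j"] \<epsilon> by (simp add: unit_ball_vol_2)
  qed simp
  also have "\<dots> = (\<Sum>k\<in>K. real (card (G k))) * (pi * \<epsilon>\<^sup>2)"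
    using K by (simp add: card_SigmaI G_def)
  finally have "(\<Sum>k\<in>K. real (card (G k))) * (pi * \<epsilon>\<^sup>2) \<le> measure lborel T" .
  moreover have "real (card K) * (1 / (2 * \<epsilon>) - 1 - real (card K) * (2 / \<delta> + 2)) \<le> (\<Sum>k\<in>K. real (card (G k)))"
    using card_G by (intro sum_bounded_below)
  then have "real (card K) * (1 / (2 * \<epsilon>) - 1 - real (card K) * (2 / \<delta> + 2)) * (pi * \<epsilon>\<^sup>2)
      \<le> (\<Sum>k\<in>K. real (card (G k))) * (pi * \<epsilon>\<^sup>2)"
    by (rule mult_right_mono) simp
  ultimately show ?thesis by linarith
qed

text \<open>Infinitely many directions supply \<open>nat \<lceil>Z\<rceil>\<close> pairwise
  nonparallel segments. Each contributes area of about \<open>pi * \<epsilon> / 2\<close>, and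
  \<open>pi / 2 > 1\<close> leaves room for the overlaps.\<close>

lemma area_curl_path_superlinear:
  assumes bdd: "bounded (curl_path \<Phi> x ` {0..})"
    and inj: "inj (\<lambda>k. cis (2 * pi * (\<Phi> ^^ k) x))"
  shows "filterlim (\<lambda>\<epsilon>. measure lborel {y. \<exists>w\<in>curl_path \<Phi> x ` {0..}. dist w y < \<epsilon>} / \<epsilon>) at_top (at_right 0)"
  unfolding filterlim_at_top
proof
  fix Z :: real
  define u where "u k = cis (2 * pi * (\<Phi> ^^ k) x)" for k
  define T where "T \<epsilon> = {y. \<exists>w\<in>curl_path \<Phi> x ` {0..}. dist w y < \<epsilon>}" for \<epsilon>
  have T_eq: "T \<epsilon> = (\<Union>w\<in>curl_path \<Phi> x ` {0..}. ball w \<epsilon>)" for \<epsilon>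
    by (auto simp: T_def)
  obtain B where B: "\<And>w. w \<in> curl_path \<Phi> x ` {0..} \<Longrightarrow> norm w \<le> B"
    using bdd by (auto simp: bounded_iff)
  have T_meas: "T \<epsilon> \<in> fmeasurable lborel" for \<epsilon>
  proof (rule fmeasurableI)
    have "norm y \<le> B + \<epsilon>" if "y \<in> T \<epsilon>" for y
    proof -
      obtain w where "w \<in> curl_path \<Phi> x ` {0..}" "dist w y < \<epsilon>"
        using \<open>y \<in> T \<epsilon>\<close> by (auto simp: T_def)
      then show ?thesis
        using B[of w] norm_triangle_sub[of y w] by (simp add: dist_norm norm_minus_commute)
    qed
    then show "emeasure lborel (T \<epsilon>) < \<infinity>"
      by (intro emeasure_bounded_finite boundedI)
    have "open (T \<epsilon>)" unfolding T_eq by blast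
    then show "T \<epsilon> \<in> sets lborel" by simp
  qed
  \<comment> \<open>Unit vectors are parallel exactly when their squares agree, so distinct squares
    select nonparallel segments; squaring is finite-to-one and keeps the range infinite.\<close>
  have "infinite (range (\<lambda>k. (u k)\<^sup>2))"
  proof
    assume fin: "finite (range (\<lambda>k. (u k)\<^sup>2))"
    have "range u \<subseteq> (\<Union>w\<in>range (\<lambda>k. (u k)\<^sup>2). {y. y\<^sup>2 = w})" by auto
    moreover have "finite (\<Union>w\<in>range (\<lambda>k. (u k)\<^sup>2). {y. y\<^sup>2 = w})"
      using fin by (intro finite_UN_I) (auto intro: finite_nth_roots)
    ultimately have "finite (range u)" by (rule finite_subset)
    then show False
      using finite_imageD[of u UNIV] inj by (simp add: u_def[abs_def])
  qed
  then obtain W where W: "W \<subseteq> range (\<lambda>k. (u k)\<^sup>2)" "finite W" "card W = nat \<lceil>Z\<rceil>"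
    using infinite_arbitrarily_large[of "range (\<lambda>k. (u k)\<^sup>2)" "nat \<lceil>Z\<rceil>"] by auto
  obtain K where inj_K: "inj_on (\<lambda>k. (u k)\<^sup>2) K" and W_eq: "W = (\<lambda>k. (u k)\<^sup>2) ` K"
    using W(1) unfolding subset_image_inj by blast
  have K: "finite K" "card K = nat \<lceil>Z\<rceil>"
    using W(2,3) finite_image_iff[OF inj_K] card_image[OF inj_K] unfolding W_eq by metis+
  define S where "S = (\<lambda>(k, l). \<bar>Im (u k * cnj (u l))\<bar>) ` {(k, l). k \<in> K \<and> l \<in> K \<and> k \<noteq> l}"
  \<comment> \<open>Inserting 1 covers the case that \<open>K\<close> has fewer than two elements
    and \<open>S\<close> is empty.\<close>
  define \<delta> where "\<delta> = Min (insert 1 S)"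
  have finS: "finite S"
    unfolding S_def by (rule finite_imageI, rule finite_subset[of _ "K \<times> K"]) (use K(1) in auto)
  have S_pos: "0 < s" if "s \<in> S" for s
  proof -
    obtain k l where kl: "k \<in> K" "l \<in> K" "k \<noteq> l" and s: "s = \<bar>Im (u k * cnj (u l))\<bar>"
      using \<open>s \<in> S\<close> by (auto simp: S_def)
    have "Im (u k * cnj (u l)) \<noteq> 0"
    proof
      assume "Im (u k * cnj (u l)) = 0"
      then have "u k * cnj (u l) \<in> \<real>"
        by (simp only: complex_is_Real_iff)
      then obtain a where a: "u k * cnj (u l) = of_real a"
        by (rule Reals_cases)
      have "\<bar>a\<bar> = 1"
        using arg_cong[OF a, of norm] by (simp add: norm_mult u_def)
      then have a2: "(of_real a :: complex)\<^sup>2 = 1"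
        by (metis of_real_1 of_real_power one_power2 power2_abs)
      have ul: "u l * cnj (u l) = 1"
        using complex_norm_square[of "u l"] by (simp add: u_def)
      have "u k = u k * (u l * cnj (u l))" unfolding ul by simp
      also have "\<dots> = of_real a * u l" using a by (simp add: mult_ac)
      finally have "(u k)\<^sup>2 = (u l)\<^sup>2"
        using a2 by (simp add: power_mult_distrib)
      then show False using inj_onD[OF inj_K _ kl(1,2)] kl(3) by simp
    qed
    then show ?thesis by (simp add: s)
  qed
  have \<delta>: "0 < \<delta>"
    unfolding \<delta>_def using finS S_pos by simp
  have transversal: "\<delta> \<le> \<bar>Im (u k * cnj (u l))\<bar>" if "k \<in> K" "l \<in> K" "k \<noteq> l" for k l
    unfolding \<delta>_def using finS that by (intro Min_le) (auto simp: S_def)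
  let ?n = "real (card K)" and ?c = "1 + real (card K) * (2 / \<delta> + 2)"
  have c: "1 \<le> ?c" using \<delta> by simp
  \<comment> \<open>The threshold makes \<open>\<epsilon> * ?c\<close> at most 1/8, and
    \<open>pi * (1/2 - 1/8) > 1\<close>.\<close>
  have "\<forall>\<^sub>F \<epsilon> in at_right 0. \<epsilon> \<in> {0<..<1 / (8 * ?c)}"
    using c by (intro eventually_at_right_real) simp
  then show "\<forall>\<^sub>F \<epsilon> in at_right 0. Z \<le> measure lborel {y. \<exists>w\<in>curl_path \<Phi> x ` {0..}. dist w y < \<epsilon>} / \<epsilon>"
  proof eventually_elim
    fix \<epsilon> :: real assume "\<epsilon> \<in> {0<..<1 / (8 * ?c)}"
    then have \<epsilon>: "0 < \<epsilon>" "\<epsilon> < 1 / (8 * ?c)" by auto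
    have "\<epsilon> * ?c \<le> 1 / (8 * ?c) * ?c"
      using \<epsilon>(2) c by (intro mult_right_mono) linarith+
    also have "\<dots> = 1 / 8" using c by simp
    finally have \<epsilon>c: "\<epsilon> * ?c \<le> 1 / 8" .
    have area: "?n * (1 / (2 * \<epsilon>) - 1 - ?n * (2 / \<delta> + 2)) * (pi * \<epsilon>\<^sup>2) \<le> measure lborel (T \<epsilon>)"
    proof (rule area_neighbourhood_segments[OF K(1) _ transversal \<delta> \<epsilon>(1) T_meas])
      fix k s assume s: "0 \<le> s" "s < (1 :: real)"
      have "curl_pt \<Phi> x k + of_real s * u k \<in> curl_path \<Phi> x ` {0..}"
        unfolding u_def curl_path_segment[OF s, symmetric] using s by (intro imageI) simp
      then show "ball (curl_pt \<Phi> x k + of_real s * u k) \<epsilon> \<subseteq> T \<epsilon>"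
        unfolding T_eq by (rule UN_upper)
    qed (auto simp: u_def)
    have "1 \<le> pi * (1 / 2 - \<epsilon> * ?c)"
    proof -
      have "1 \<le> 3 * (3 / 8 :: real)" by simp
      also have "\<dots> \<le> pi * (1 / 2 - \<epsilon> * ?c)"
        using \<epsilon>c pi_gt3 by (intro mult_mono) auto
      finally show ?thesis .
    qed
    then have "?n * 1 \<le> ?n * (pi * (1 / 2 - \<epsilon> * ?c))"
      by (rule mult_left_mono) simp
    also have "\<dots> = ?n * (1 / (2 * \<epsilon>) - 1 - ?n * (2 / \<delta> + 2)) * (pi * \<epsilon>\<^sup>2) / \<epsilon>"
    proof -
      have *: "a * (pi * (1 / 2 - \<epsilon> * (1 + b))) = a * (1 / (2 * \<epsilon>) - 1 - b) * (pi * \<epsilon>\<^sup>2) / \<epsilon>" for a b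
        using \<epsilon>(1) by (simp add: field_simps power2_eq_square)
      show ?thesis by (rule *)
    qed
    also have "\<dots> \<le> measure lborel (T \<epsilon>) / \<epsilon>"
      using area \<epsilon>(1) by (intro divide_right_mono) auto
    finally have "?n \<le> measure lborel (T \<epsilon>) / \<epsilon>" by simp
    moreover have "Z \<le> ?n" unfolding K(2) by linarith
    ultimately show "Z \<le> measure lborel {y. \<exists>w\<in>curl_path \<Phi> x ` {0..}. dist w y < \<epsilon>} / \<epsilon>"
      unfolding T_def by linarith
  qed
qed

section \<open>Vanishing and nonvanishing mean\<close>

lemma cis_2pi_eq_imp_diff_Ints:
  assumes "cis (2 * pi * a) = cis (2 * pi * b)"
  shows "a - b \<in> \<int>"
proof -
  have "cis (2 * pi * (a - b)) = cis (2 * pi * a) / cis (2 * pi * b)"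
    by (simp only: cis_divide right_diff_distrib)
  also have "\<dots> = 1" using assms by simp
  finally have "cos (2 * pi * (a - b)) = 1"
    by (metis cis.sel(1) one_complex.sel(1))
  then obtain n where "2 * pi * (a - b) = of_int n * 2 * pi"
    by (auto simp: cos_one_2pi_int)
  then have "a - b = of_int n" by simp
  then show ?thesis by simp
qed

theorem theorem4p3:
  fixes \<Phi> :: "real \<Rightarrow> real" and \<rho> :: real and \<mu> :: "real measure"
  assumes lift: "circle_homeo_lift \<Phi>"
    and rot: "rotation_number \<Phi> \<rho>"
    and irr: "\<rho> \<notin> \<rat>"
    and inv: "invariant_prob_measure \<Phi> \<mu>"
    and uniq: "\<forall>\<nu>. invariant_prob_measure \<Phi> \<nu> \<longrightarrow> \<nu> = \<mu>"
  defines "v \<equiv> integral\<^sup>L \<mu> (\<lambda>x. cis (2 * pi * x))"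
  shows
   "(v = 0 \<longrightarrow>
      (\<forall>r>1. diophantine_type \<rho> r \<longrightarrow>
         (\<forall>x0. (\<lambda>n. norm (curl_pt \<Phi> x0 n)) \<in> O(\<lambda>n. real n powr (1 - 1 / r) * ln (real n)))) \<and>
      (bounded_type \<rho> \<longrightarrow>
         (\<forall>x0. (\<lambda>n. norm (curl_pt \<Phi> x0 n)) \<in> O(\<lambda>n. ln (real n)))) \<and>
      (\<forall>\<epsilon>>0. slow_quotients \<rho> \<epsilon> \<longrightarrow>
         (\<forall>x0. (\<lambda>n. norm (curl_pt \<Phi> x0 n)) \<in> O(\<lambda>n. ln (real n) powr (2 + \<epsilon>)))) \<and>
      ((\<exists>r>1. diophantine_type \<rho> r) \<or> bounded_type \<rho> \<or> (\<exists>\<epsilon>>0. slow_quotients \<rho> \<epsilon>) \<longrightarrow>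
         (\<forall>x0. superficial (curl_path \<Phi> x0)))) \<and>
    (v \<noteq> 0 \<longrightarrow>
      (\<forall>x0. \<not> superficial (curl_path \<Phi> x0)) \<and>
      ((\<exists>r>1. diophantine_type \<rho> r) \<or> bounded_type \<rho> \<or> (\<exists>\<epsilon>>0. slow_quotients \<rho> \<epsilon>) \<longrightarrow>
         (\<exists>(M::real) (l::nat \<Rightarrow> real). l \<in> o(\<lambda>n. real n) \<and>
            (\<forall>x0 n. norm (curl_pt \<Phi> x0 n - of_nat n * v) \<le> M * l n))))"
proof -
  have v: "v = integral\<^sup>L \<mu> (\<lambda>x. cis (2 * pi * x))" by (simp add: v_def)
  note hyps = lift rot irr inv v
  let ?D = "orbit_discrepancy \<Phi> v"
  have D0: "?D x n = norm (curl_pt \<Phi> x n)" if "v = 0" for x n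
    using that by (simp add: orbit_discrepancy_def)
  \<comment> \<open>Sublinear growth settles the unbounded branch of \<open>superficial\<close>, the
    distinct directions of an aperiodic orbit the bounded one.\<close>
  have superficial_0: "superficial (curl_path \<Phi> x0)" if "v = 0" for x0
  proof -
    have sublinear: "\<forall>\<^sub>F n in sequentially. norm (curl_pt \<Phi> x0 n) \<le> c * real n" if "0 < c" for c
      using discrepancy_smallo_uniform[OF hyps that] unfolding D0[OF \<open>v = 0\<close>]
      by (rule eventually_mono) blast
    have "inj (\<lambda>k. cis (2 * pi * (\<Phi> ^^ k) x0))"
      using lift_orbit_aperiodic[OF lift rot irr] by (intro injI) (blast dest: cis_2pi_eq_imp_diff_Ints)
    then show ?thesis
      unfolding superficial_def
      using area_curl_path_superlinear diameter_curl_path_sublinear[OF sublinear] by auto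
  qed
  \<comment> \<open>A discrepancy of at most half of \<open>norm v\<close> per step leaves linear
    growth at the other half.\<close>
  have not_superficial: "\<not> superficial (curl_path \<Phi> x0)" if "v \<noteq> 0" for x0
  proof (rule not_superficial_if_linear_growth)
    show c: "0 < norm v / 2" using that by simp
    show "\<forall>\<^sub>F n in sequentially. norm v / 2 * real n \<le> norm (curl_pt \<Phi> x0 n)"
      using discrepancy_smallo_uniform[OF hyps c]
    proof eventually_elim
      fix n assume "\<forall>x. ?D x n \<le> norm v / 2 * real n"
      then have "norm (curl_pt \<Phi> x0 n - of_nat n * v) \<le> norm v / 2 * real n"
        by (simp add: orbit_discrepancy_def)
      moreover have "norm (of_nat n * v) = norm v * real n"
        by (simp add: norm_mult)
      ultimately show "norm v / 2 * real n \<le> norm (curl_pt \<Phi> x0 n)"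
        using norm_triangle_ineq3[of "curl_pt \<Phi> x0 n" "of_nat n * v"] by (simp add: abs_le_iff)
    qed
  qed
  have bdd: "bdd_above (range (\<lambda>x. ?D x n))" for n
    using discrepancy_le[OF hyps] by (intro bdd_aboveI2)
  \<comment> \<open>The worst case over all starting points serves with \<open>M = 1\<close>: finite
    by \<open>discrepancy_le\<close>, and \<open>o(n)\<close> because the estimate is uniform in the
    starting point.\<close>
  define l where "l n = (SUP x. ?D x n)" for n
  have D_le_l: "?D x n \<le> l n" for x n
    unfolding l_def by (rule cSUP_upper[OF _ bdd]) simp
  have l_nonneg: "0 \<le> l n" for n
    by (rule order_trans[OF _ D_le_l[of 0]]) (simp add: orbit_discrepancy_def)
  have "l \<in> o(\<lambda>n. real n)"
  proof (rule landau_o.smallI)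
    fix c :: real assume "0 < c"
    show "\<forall>\<^sub>F n in sequentially. norm (l n) \<le> c * norm (real n)"
      using discrepancy_smallo_uniform[OF hyps \<open>0 < c\<close>]
    proof eventually_elim
      fix n assume "\<forall>x. ?D x n \<le> c * real n"
      then have "l n \<le> c * real n"
        unfolding l_def by (intro cSUP_least) auto
      then show "norm (l n) \<le> c * norm (real n)"
        using l_nonneg[of n] by simp
    qed
  qed
  then have bound: "\<exists>(M::real) (l::nat \<Rightarrow> real). l \<in> o(\<lambda>n. real n) \<and>
      (\<forall>x0 n. norm (curl_pt \<Phi> x0 n - of_nat n * v) \<le> M * l n)"
    using D_le_l by (intro exI[of _ 1] exI[of _ l]) (simp add: orbit_discrepancy_def)
  show ?thesis
  proof (cases "v = 0")
    case True
    then show ?thesis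
      using superficial_0[OF True] discrepancy_diophantine[OF hyps, unfolded D0[OF True]]
        discrepancy_bounded_type[OF hyps, unfolded D0[OF True]]
        discrepancy_slow_quotients[OF hyps, unfolded D0[OF True]]
      by blast
  next
    case False
    then show ?thesis
      using not_superficial[OF False] bound by blast
  qed
qed

end
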